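(* Let $S$ be a semigroup that is cancellative (left and right) and satisfies Clifford's condition. Then the canonical surjective $*$-homomorphism $h:C^*_{r,0}(I_l(S))\to C^*_r(S)$, determined by $h(\Lambda_0(f))=\omega(f)$ for all $f\in I_l(S)$, is an isomorphism.
   Context: A semigroup means a set with associative product and identity element $1$. $S$ satisfies Clifford's condition if for all $s,t\in S$, either $sS\cap tS=\varnothing$ or $sS\cap tS=rS$ for some $r\in S$. For $s\in S$ let $\lambda_s:S\to sS$, $\lambda_s(t)=st$. $I(S)$ is the inverse semigroup of all partially defined bijections of $S$ (product $fg$ is composition on $g^{-1}(\mathrm{dom} f)$; $f^*$ is the inverse map; the empty map is the zero $0$). $I_l(S)$ is the inverse subsemigroup of $I(S)$ generated by $\{\lambda_s\}_{s\in S}$. $\{\varepsilon_s\}$ is the canonical orthonormal basis of $\ell^2(S)$, $V_s\varepsilon_t=\varepsilon_{st}$, and $C^*_r(S)\subset B(\ell^2(S))$ is the $C^*$-algebra generated by $\{V_s:s\in S\}$. For $f\in I_l(S)$, $\omega(f)\varepsilon_s=\varepsilon_{f(s)}$ if $s\in\mathrm{dom}(f)$ and $0$ otherwise. For an inverse semigroup $P$, with canonical basis $\{\delta_q\}_{q\in P}$ of $\ell^2(P)$, $\Lambda(p)\delta_q=\delta_{pq}$ if $p^*pq=q$ and $0$ otherwise; $C^*_r(P)$ is the closed linear span of $\Lambda(P)$ in $B(\ell^2(P))$. If $P=I_l(S)$ contains the empty map $0$, $C^*_{r,0}(P)=C^*_r(P)/\mathbb{C}\Lambda(0)$; otherwise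 $C^*_{r,0}(P)=C^*_r(P)$. $\Lambda_0(p)$ is the image of $\Lambda(p)$ in $C^*_{r,0}(P)$. The $*$-homomorphism $h$ with the stated property exists and is unique. *)

theory Defs
  imports "HOL-Analysis.Analysis"
begin

section \<open>The Hilbert space of square-summable functions\<close>

typedef 'a ell2 = "{v :: 'a \<Rightarrow> complex. (\<lambda>i. (cmod (v i))\<^sup>2) summable_on UNIV}"
  morphisms coord Abs_ell2
  by (rule exI[of _ "\<lambda>_. 0"]) simp

setup_lifting type_definition_ell2

lemma coord_summable: "(\<lambda>i. (cmod (coord v i))\<^sup>2) summable_on UNIV"
  using coord by blast

lemma ell2_cong: "(\<And>i. coord v i = coord w i) \<Longrightarrow> v = w"
  by (metis coord_inject ext)

lemma ell2_add_summable:
  assumes "(\<lambda>i. (cmod (v i))\<^sup>2) summable_on UNIV" "(\<lambda>i. (cmod (w i))\<^sup>2) summable_on UNIV"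
  shows "(\<lambda>i. (cmod (v i + w i))\<^sup>2) summable_on UNIV"
proof (rule summable_on_comparison_test)
  show "(\<lambda>i. 2 * (cmod (v i))\<^sup>2 + 2 * (cmod (w i))\<^sup>2) summable_on UNIV"
    by (intro summable_on_add summable_on_cmult_right assms)
  show "(cmod (v i + w i))\<^sup>2 \<le> 2 * (cmod (v i))\<^sup>2 + 2 * (cmod (w i))\<^sup>2" for i
  proof -
    have "(cmod (v i + w i))\<^sup>2 \<le> (cmod (v i) + cmod (w i))\<^sup>2"
      by (intro power_mono norm_triangle_ineq norm_ge_zero)
    also have "\<dots> \<le> 2 * (cmod (v i))\<^sup>2 + 2 * (cmod (w i))\<^sup>2"
      using sum_squares_bound[of "cmod (v i)" "cmod (w i)"] by (simp add: power2_sum)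
    finally show ?thesis .
  qed
qed auto

lift_definition scaleC :: "complex \<Rightarrow> 'a ell2 \<Rightarrow> 'a ell2" (infixr "*\<^sub>C" 75)
  is "\<lambda>c v i. c * v i"
  by (simp add: norm_mult power_mult_distrib summable_on_cmult_right)

lift_definition ket :: "'a \<Rightarrow> 'a ell2"
  is "\<lambda>a i. if i = a then 1 else 0"
proof -
  fix a :: 'a
  have "(\<lambda>i. (cmod (if i = a then 1 else 0))\<^sup>2) summable_on {a}"
    by simp
  then show "(\<lambda>i. (cmod (if i = a then 1 else 0))\<^sup>2) summable_on UNIV"
    by (rule summable_on_cong_neutral[THEN iffD1, rotated -1]) auto
qed

definition cinner :: "'a ell2 \<Rightarrow> 'a ell2 \<Rightarrow> complex"
  where "cinner v w = (\<Sum>\<^sub>\<infinity>i. cnj (coord v i) * coord w i)"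

lemma cinner_summable: "(\<lambda>i. cnj (coord v i) * coord w i) summable_on UNIV"
proof (rule abs_summable_summable)
  show "(\<lambda>i. norm (cnj (coord v i) * coord w i)) summable_on UNIV"
  proof (rule summable_on_comparison_test)
    show "(\<lambda>i. (cmod (coord v i))\<^sup>2 + (cmod (coord w i))\<^sup>2) summable_on UNIV"
      by (intro summable_on_add coord_summable)
    show "norm (cnj (coord v i) * coord w i) \<le> (cmod (coord v i))\<^sup>2 + (cmod (coord w i))\<^sup>2" for i
      using sum_squares_bound[of "cmod (coord v i)" "cmod (coord w i)"]
        mult_nonneg_nonneg[OF norm_ge_zero[of "coord v i"] norm_ge_zero[of "coord w i"]]
      unfolding norm_mult complex_mod_cnj by linarith
  qed auto
qed

lemma cinner_self: "cinner v v = complex_of_real (\<Sum>\<^sub>\<infinity>i. (cmod (coord v i))\<^sup>2)"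
proof -
  have "((\<lambda>i. complex_of_real ((cmod (coord v i))\<^sup>2)) has_sum
      complex_of_real (\<Sum>\<^sub>\<infinity>i. (cmod (coord v i))\<^sup>2)) UNIV"
    by (intro has_sum_of_real has_sum_infsum coord_summable)
  then have "(\<Sum>\<^sub>\<infinity>i. complex_of_real ((cmod (coord v i))\<^sup>2)) =
      complex_of_real (\<Sum>\<^sub>\<infinity>i. (cmod (coord v i))\<^sup>2)"
    by (rule infsumI)
  moreover have "cnj z * z = complex_of_real ((cmod z)\<^sup>2)" for z
    by (metis complex_norm_square mult.commute of_real_power)
  ultimately show ?thesis
    by (simp add: cinner_def)
qed

instantiation ell2 :: (type) real_vector
begin

lift_definition zero_ell2 :: "'a ell2" is "\<lambda>_. 0"
  by simp

lift_definition plus_ell2 :: "'a ell2 \<Rightarrow> 'a ell2 \<Rightarrow> 'a ell2" is "\<lambda>v w i. v i + w i"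
  by (rule ell2_add_summable)

lift_definition uminus_ell2 :: "'a ell2 \<Rightarrow> 'a ell2" is "\<lambda>v i. - v i"
  by simp

definition minus_ell2 :: "'a ell2 \<Rightarrow> 'a ell2 \<Rightarrow> 'a ell2"
  where "minus_ell2 v w = v + (- w)"

definition scaleR_ell2 :: "real \<Rightarrow> 'a ell2 \<Rightarrow> 'a ell2"
  where "scaleR_ell2 r v = complex_of_real r *\<^sub>C v"

instance
proof
  fix u v w :: "'a ell2" and r s :: real
  show "u + v + w = u + (v + w)" "u + v = v + u" "0 + u = u" "- u + u = 0"
    by (transfer; simp add: algebra_simps fun_eq_iff)+
  show "u - v = u + - v" by (simp add: minus_ell2_def)
  show "r *\<^sub>R (u + v) = r *\<^sub>R u + r *\<^sub>R v" "(r + s) *\<^sub>R u = r *\<^sub>R u + s *\<^sub>R u"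
    "r *\<^sub>R s *\<^sub>R u = (r * s) *\<^sub>R u" "1 *\<^sub>R u = u"
    unfolding scaleR_ell2_def by (transfer; simp add: algebra_simps fun_eq_iff)+
qed

end

instantiation ell2 :: (type) real_inner
begin

definition inner_ell2 :: "'a ell2 \<Rightarrow> 'a ell2 \<Rightarrow> real"
  where "inner_ell2 v w = Re (cinner v w)"

definition norm_ell2 :: "'a ell2 \<Rightarrow> real"
  where "norm_ell2 v = sqrt (inner v v)"

definition sgn_ell2 :: "'a ell2 \<Rightarrow> 'a ell2"
  where "sgn_ell2 v = v /\<^sub>R norm v"

definition dist_ell2 :: "'a ell2 \<Rightarrow> 'a ell2 \<Rightarrow> real"
  where "dist_ell2 v w = norm (v - w)"

definition uniformity_ell2 :: "('a ell2 \<times> 'a ell2) filter"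
  where "uniformity_ell2 = (INF e\<in>{0 <..}. principal {(v, w). dist v w < e})"

definition open_ell2 :: "'a ell2 set \<Rightarrow> bool"
  where "open_ell2 U \<longleftrightarrow> (\<forall>v\<in>U. eventually (\<lambda>(v', w). v' = v \<longrightarrow> w \<in> U) uniformity)"

instance
proof
  fix u v w :: "'a ell2" and r :: real
  show "sgn u = u /\<^sub>R norm u" "dist u v = norm (u - v)" "norm u = sqrt (inner u u)"
    by (simp_all add: sgn_ell2_def dist_ell2_def norm_ell2_def)
  show "uniformity = (INF e\<in>{0 <..}. principal {(v :: 'a ell2, w). dist v w < e})"
    by (simp add: uniformity_ell2_def)
  show "open U \<longleftrightarrow> (\<forall>v\<in>U. eventually (\<lambda>(v', w). v' = v \<longrightarrow> w \<in> U) uniformity)"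
    for U :: "'a ell2 set" by (simp add: open_ell2_def)
  have "cinner v u = cnj (cinner u v)"
    unfolding cinner_def infsum_cnj[symmetric] by (simp add: mult.commute)
  then show "inner u v = inner v u" by (simp add: inner_ell2_def)
  have "cinner (u + v) w = cinner u w + cinner v w"
    unfolding cinner_def infsum_add[OF cinner_summable cinner_summable, symmetric]
    by (simp add: plus_ell2.rep_eq algebra_simps)
  then show "inner (u + v) w = inner u w + inner v w" by (simp add: inner_ell2_def)
  have "cinner (r *\<^sub>R u) v = complex_of_real r * cinner u v"
    unfolding cinner_def infsum_cmult_right'[symmetric]
    by (simp add: scaleR_ell2_def scaleC.rep_eq algebra_simps)
  then show "inner (r *\<^sub>R u) v = r * inner u v" by (simp add: inner_ell2_def)
  show "0 \<le> inner u u"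
    unfolding inner_ell2_def cinner_self by (simp add: infsum_nonneg)
  show "inner u u = 0 \<longleftrightarrow> u = 0"
  proof
    assume "inner u u = 0"
    then have "(\<Sum>\<^sub>\<infinity>i. (cmod (coord u i))\<^sup>2) = 0" by (simp add: inner_ell2_def cinner_self)
    then have "(cmod (coord u i))\<^sup>2 = 0" for i
      using nonneg_infsum_le_0D[of "\<lambda>i. (cmod (coord u i))\<^sup>2" UNIV i] coord_summable[of u] by simp
    then show "u = 0" by (intro ell2_cong) (simp add: zero_ell2.rep_eq)
  next
    show "inner u u = 0" if "u = 0"
      by (simp add: that inner_ell2_def cinner_def zero_ell2.rep_eq)
  qed
qed

end

lemma norm_ell2_sq: "(norm v)\<^sup>2 = (\<Sum>\<^sub>\<infinity>i. (cmod (coord v i))\<^sup>2)" for v :: "'a ell2"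
  by (simp add: power2_norm_eq_inner inner_ell2_def cinner_self)


section \<open>Operators on the Hilbert space\<close>

text \<open>The library's type of bounded operators is only real-linear; \<open>clinear_ops\<close> below is the
  algebra of all bounded complex-linear operators.\<close>

type_synonym 'a op = "'a ell2 \<Rightarrow>\<^sub>L 'a ell2"

lemma norm_scaleC: "norm (c *\<^sub>C v) = cmod c * norm v"
proof (rule power2_eq_imp_eq)
  show "(norm (c *\<^sub>C v))\<^sup>2 = (cmod c * norm v)\<^sup>2"
    by (simp add: norm_ell2_sq power_mult_distrib scaleC.rep_eq norm_mult infsum_cmult_right')
qed auto

lift_definition scalar_op :: "complex \<Rightarrow> 'a op" is "\<lambda>c v. c *\<^sub>C v"
proof (rule bounded_linear_intro)
  fix c :: complex and v w :: "'a ell2" and r :: real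
  show "c *\<^sub>C (v + w) = c *\<^sub>C v + c *\<^sub>C w"
    by transfer (simp add: algebra_simps)
  show "c *\<^sub>C r *\<^sub>R v = r *\<^sub>R c *\<^sub>C v"
    unfolding scaleR_ell2_def by transfer (simp add: algebra_simps)
  show "norm (c *\<^sub>C v) \<le> norm v * cmod c"
    by (simp add: norm_scaleC)
qed

definition clinear_ops :: "'a op set"
  where "clinear_ops = {T. \<forall>c v. blinfun_apply T (c *\<^sub>C v) = c *\<^sub>C blinfun_apply T v}"

definition scale_op :: "complex \<Rightarrow> 'a op \<Rightarrow> 'a op"
  where "scale_op c T = scalar_op c o\<^sub>L T"

lemma scale_op_apply: "blinfun_apply (scale_op c T) v = c *\<^sub>C blinfun_apply T v"
  by (simp add: scale_op_def scalar_op.rep_eq)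

interpretation op: vector_space "scale_op :: complex \<Rightarrow> 'a op \<Rightarrow> 'a op"
proof
  fix c d :: complex and T R :: "'a op"
  have sc: "c *\<^sub>C (v + w) = c *\<^sub>C v + c *\<^sub>C w" "(c + d) *\<^sub>C v = c *\<^sub>C v + d *\<^sub>C v"
    "c *\<^sub>C d *\<^sub>C v = (c * d) *\<^sub>C v" "1 *\<^sub>C v = v" for v w :: "'a ell2"
    by (transfer; simp add: algebra_simps)+
  show "scale_op c (T + R) = scale_op c T + scale_op c R"
    "scale_op (c + d) T = scale_op c T + scale_op d T"
    "scale_op c (scale_op d T) = scale_op (c * d) T" "scale_op 1 T = T"
    by (auto intro!: blinfun_eqI simp: scale_op_apply blinfun.add_left sc)
qed

abbreviation cspan :: "'a op set \<Rightarrow> 'a op set"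
  where "cspan \<equiv> module.span scale_op"

text \<open>The description is uniquely satisfied for every \<open>T\<close> in \<open>clinear_ops\<close>, by the Riesz representation
  theorem.\<close>

definition adj :: "'a op \<Rightarrow> 'a op"
  where "adj T = (THE R. \<forall>v w. cinner (blinfun_apply R v) w = cinner v (blinfun_apply T w))"

definition cstar_subalgebra :: "'a op set \<Rightarrow> bool"
  where "cstar_subalgebra A \<longleftrightarrow> A \<subseteq> clinear_ops \<and> closed A \<and> 0 \<in> A \<and>
    (\<forall>T\<in>A. \<forall>R\<in>A. T + R \<in> A) \<and> (\<forall>c. \<forall>T\<in>A. scale_op c T \<in> A) \<and>
    (\<forall>T\<in>A. \<forall>R\<in>A. T o\<^sub>L R \<in> A) \<and> (\<forall>T\<in>A. adj T \<in> A)"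

definition cstar_generated :: "'a op set \<Rightarrow> 'a op set"
  where "cstar_generated X = \<Inter> {A. cstar_subalgebra A \<and> X \<subseteq> A}"


section \<open>Operators induced by partial injections\<close>

text \<open>For an injective partial map \<open>f\<close>, \<open>pinv f\<close> is the inverse partial map. It is an injective
  partial map for every \<open>f\<close>, so that \<open>partial_op f\<close> is always bounded; \<open>partial_op_ket\<close>
  gives its action on the canonical basis for injective \<open>f\<close>.\<close>

definition pinv :: "('a \<rightharpoonup> 'b) \<Rightarrow> ('b \<rightharpoonup> 'a)"
  where "pinv f y = (if \<exists>x. f x = Some y then Some (SOME x. f x = Some y) else None)"

lemma pinv_SomeD: "pinv f y = Some x \<Longrightarrow> f x = Some y"
  unfolding pinv_def by (auto split: if_splits intro: someI_ex)

lemma pinv_eq_Some_iff: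
  assumes "inj_on f (dom f)"
  shows "pinv f y = Some x \<longleftrightarrow> f x = Some y"
proof
  assume fx: "f x = Some y"
  then have "\<exists>x. f x = Some y" ..
  then obtain x' where x': "pinv f y = Some x'" unfolding pinv_def by simp
  then have "f x' = f x" using fx pinv_SomeD[OF x'] by simp
  then have "x' = x" by (rule inj_onD[OF assms]) (use fx \<open>f x' = f x\<close> in auto)
  with x' show "pinv f y = Some x" by simp
qed (rule pinv_SomeD)

lemma inj_pinv: "inj_on (pinv f) (dom (pinv f))"
proof (rule inj_onI)
  fix y y' assume "y \<in> dom (pinv f)" "pinv f y = pinv f y'"
  then obtain x where "pinv f y = Some x" "pinv f y' = Some x" by (metis domD)
  then have "f x = Some y" "f x = Some y'" by (auto dest: pinv_SomeD)
  then show "y = y'" by simp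
qed

definition pull :: "('a \<rightharpoonup> 'a) \<Rightarrow> ('a \<Rightarrow> complex) \<Rightarrow> 'a \<Rightarrow> complex"
  where "pull f v t = (case pinv f t of None \<Rightarrow> 0 | Some s \<Rightarrow> v s)"

lemma pull_summable:
  assumes "(\<lambda>i. (cmod (v i))\<^sup>2) summable_on UNIV"
  shows "(\<lambda>i. (cmod (pull f v i))\<^sup>2) summable_on UNIV"
    and "(\<Sum>\<^sub>\<infinity>i. (cmod (pull f v i))\<^sup>2) \<le> (\<Sum>\<^sub>\<infinity>i. (cmod (v i))\<^sup>2)"
proof -
  let ?D = "dom (pinv f)" and ?g = "the \<circ> pinv f"
  have inj: "inj_on ?g ?D"
    using inj_pinv[of f] by (auto simp: inj_on_def dom_def)
  have eq: "(cmod (pull f v i))\<^sup>2 = ((\<lambda>i. (cmod (v i))\<^sup>2) \<circ> ?g) i" if "i \<in> ?D" for i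
    using that by (auto simp: pull_def)
  have z: "(cmod (pull f v i))\<^sup>2 = 0" if "i \<notin> ?D" for i
    using that by (simp add: pull_def domIff)
  have img: "(\<lambda>i. (cmod (v i))\<^sup>2) summable_on ?g ` ?D"
    using assms by (rule summable_on_subset_banach) simp
  then have "((\<lambda>i. (cmod (v i))\<^sup>2) \<circ> ?g) summable_on ?D"
    using summable_on_reindex[OF inj] by blast
  then have "(\<lambda>i. (cmod (pull f v i))\<^sup>2) summable_on ?D"
    using summable_on_cong[OF eq, of ?D "\<lambda>i. i"] by (simp add: comp_def)
  then show s: "(\<lambda>i. (cmod (pull f v i))\<^sup>2) summable_on UNIV"
    by (rule summable_on_cong_neutral[THEN iffD1, rotated -1]) (use z in auto)
  have "(\<Sum>\<^sub>\<infinity>i. (cmod (pull f v i))\<^sup>2) = (\<Sum>\<^sub>\<infinity>i\<in>?D. (cmod (pull f v i))\<^sup>2)"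
    by (rule infsum_cong_neutral) (use z in auto)
  also have "\<dots> = (\<Sum>\<^sub>\<infinity>i\<in>?D. ((\<lambda>i. (cmod (v i))\<^sup>2) \<circ> ?g) i)"
    by (rule infsum_cong) (rule eq)
  also have "\<dots> = (\<Sum>\<^sub>\<infinity>i\<in>?g ` ?D. (cmod (v i))\<^sup>2)"
    using infsum_reindex[OF inj, of "\<lambda>i. (cmod (v i))\<^sup>2"] by (simp add: comp_def)
  also have "\<dots> \<le> (\<Sum>\<^sub>\<infinity>i. (cmod (v i))\<^sup>2)"
    by (rule infsum_mono_neutral) (use img assms in auto)
  finally show "(\<Sum>\<^sub>\<infinity>i. (cmod (pull f v i))\<^sup>2) \<le> (\<Sum>\<^sub>\<infinity>i. (cmod (v i))\<^sup>2)" .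
qed

lift_definition pull_ell2 :: "('a \<rightharpoonup> 'a) \<Rightarrow> 'a ell2 \<Rightarrow> 'a ell2" is pull
  by (rule pull_summable)

lift_definition partial_op :: "('a \<rightharpoonup> 'a) \<Rightarrow> 'a op" is pull_ell2
proof (rule bounded_linear_intro)
  fix f :: "'a \<rightharpoonup> 'a" and v w :: "'a ell2" and r :: real
  show "pull_ell2 f (v + w) = pull_ell2 f v + pull_ell2 f w"
    by transfer (auto simp: pull_def fun_eq_iff split: option.splits)
  show "pull_ell2 f (r *\<^sub>R v) = r *\<^sub>R pull_ell2 f v"
    unfolding scaleR_ell2_def by transfer (auto simp: pull_def fun_eq_iff split: option.splits)
  show "norm (pull_ell2 f v) \<le> norm v * 1"
    by (simp, rule power2_le_imp_le)
      (use pull_summable(2)[OF coord_summable] in \<open>auto simp: norm_ell2_sq pull_ell2.rep_eq\<close>)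
qed

lemma partial_op_clinear: "partial_op f \<in> clinear_ops"
  unfolding clinear_ops_def partial_op.rep_eq mem_Collect_eq
  by (intro allI, transfer) (auto simp: pull_def fun_eq_iff split: option.splits)

lemma partial_op_ket:
  assumes "inj_on f (dom f)"
  shows "blinfun_apply (partial_op f) (ket s) = (case f s of None \<Rightarrow> 0 | Some t \<Rightarrow> ket t)"
proof (rule ell2_cong)
  fix i
  show "coord (blinfun_apply (partial_op f) (ket s)) i =
      coord (case f s of None \<Rightarrow> 0 | Some t \<Rightarrow> ket t) i"
  proof (cases "pinv f i")
    case None
    then have "f s \<noteq> Some i" unfolding pinv_def by (auto split: if_splits)
    with None show ?thesis
      by (auto simp: partial_op.rep_eq pull_ell2.rep_eq pull_def zero_ell2.rep_eq ket.rep_eq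
          split: option.splits)
  next
    case (Some x)
    then have fx: "f x = Some i" by (rule pinv_SomeD)
    have "x = s" if "f s = Some i"
      using assms that fx by (metis domI inj_on_def)
    with Some fx show ?thesis
      by (auto simp: partial_op.rep_eq pull_ell2.rep_eq pull_def zero_ell2.rep_eq ket.rep_eq
          split: option.splits)
  qed
qed


section \<open>Cancellative monoids and the left inverse hull\<close>

class left_cancel_monoid_mult = monoid_mult +
  assumes mult_left_imp_eq: "a * b = a * c \<Longrightarrow> b = c"

class cancel_monoid_mult = left_cancel_monoid_mult +
  assumes mult_right_imp_eq: "b * a = c * a \<Longrightarrow> b = c"

definition clifford_condition :: "'a::monoid_mult itself \<Rightarrow> bool"
  where "clifford_condition _ \<longleftrightarrow> (\<forall>s t :: 'a.
    range ((*) s) \<inter> range ((*) t) = {} \<or> (\<exists>r. range ((*) s) \<inter> range ((*) t) = range ((*) r)))"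

definition lmult :: "'a::monoid_mult \<Rightarrow> 'a \<rightharpoonup> 'a"
  where "lmult s = (\<lambda>t. Some (s * t))"

text \<open>Here \<open>f \<circ>\<^sub>m g\<close> is the composition of partial maps, defined where \<open>g\<close> is defined with
  value in the domain of \<open>f\<close>.\<close>

inductive_set hull_maps :: "('a::monoid_mult \<rightharpoonup> 'a) set"
  where
    lmult: "lmult s \<in> hull_maps"
  | comp: "f \<in> hull_maps \<Longrightarrow> g \<in> hull_maps \<Longrightarrow> f \<circ>\<^sub>m g \<in> hull_maps"
  | pinv: "f \<in> hull_maps \<Longrightarrow> pinv f \<in> hull_maps"

lemma inj_lmult: "inj_on (lmult s) (dom (lmult s))" for s :: "'a::left_cancel_monoid_mult"
  by (auto simp: inj_on_def lmult_def dest: mult_left_imp_eq)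

lemma map_comp_inj:
  assumes "inj_on f (dom f)" "inj_on g (dom g)"
  shows "inj_on (f \<circ>\<^sub>m g) (dom (f \<circ>\<^sub>m g))"
  using assms by (auto simp: inj_on_def map_comp_def dom_def split: option.splits)

lemma hull_maps_inj: "f \<in> hull_maps \<Longrightarrow> inj_on f (dom f)"
  for f :: "'a::left_cancel_monoid_mult \<rightharpoonup> 'a"
  by (induction rule: hull_maps.induct) (auto intro: inj_lmult map_comp_inj inj_pinv)

class inverse_semigroup = semigroup_mult +
  fixes inv_elt :: "'a \<Rightarrow> 'a"
  assumes mult_inv_mult: "a * inv_elt a * a = a"
    and inv_mult_inv: "inv_elt a * a * inv_elt a = inv_elt a"
    and inv_unique: "a * b * a = a \<Longrightarrow> b * a * b = b \<Longrightarrow> b = inv_elt a"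

typedef (overloaded) 'a left_inverse_hull = "hull_maps :: ('a::left_cancel_monoid_mult \<rightharpoonup> 'a) set"
  morphisms pmap Abs_left_inverse_hull
  using hull_maps.lmult by blast

setup_lifting type_definition_left_inverse_hull

lemma inj_pmap: "inj_on (pmap f) (dom (pmap f))"
  using pmap by (rule hull_maps_inj)

instantiation left_inverse_hull :: (left_cancel_monoid_mult) inverse_semigroup
begin

lift_definition times_left_inverse_hull ::
  "'a left_inverse_hull \<Rightarrow> 'a left_inverse_hull \<Rightarrow> 'a left_inverse_hull" is "(\<circ>\<^sub>m)"
  by (rule hull_maps.comp)

lift_definition inv_elt_left_inverse_hull :: "'a left_inverse_hull \<Rightarrow> 'a left_inverse_hull" is pinv
  by (rule hull_maps.pinv)

instance
proof
  fix a b c :: "'a left_inverse_hull"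
  show "a * b * c = a * (b * c)"
    by transfer (auto simp: map_comp_def fun_eq_iff split: option.splits)
  have *: "pmap b y = Some x \<longleftrightarrow> pinv (pmap b) x = Some y" for b :: "'a left_inverse_hull" and x y
    using pinv_eq_Some_iff[OF inj_pmap] by metis
  show "a * inv_elt a * a = a"
  proof (rule pmap_inject[THEN iffD1], rule ext)
    fix x
    show "pmap (a * inv_elt a * a) x = pmap a x"
    proof (cases "pmap a x")
      case (Some y)
      then have "pinv (pmap a) y = Some x" by (simp add: *)
      with Some show ?thesis
        by (simp add: times_left_inverse_hull.rep_eq inv_elt_left_inverse_hull.rep_eq)
    qed (simp add: times_left_inverse_hull.rep_eq)
  qed
  show "inv_elt a * a * inv_elt a = inv_elt a"
  proof (rule pmap_inject[THEN iffD1], rule ext)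
    fix y
    show "pmap (inv_elt a * a * inv_elt a) y = pmap (inv_elt a) y"
    proof (cases "pinv (pmap a) y")
      case (Some x)
      then have "pmap a x = Some y" by (rule pinv_SomeD)
      with Some show ?thesis
        by (simp add: times_left_inverse_hull.rep_eq inv_elt_left_inverse_hull.rep_eq)
    qed (simp add: times_left_inverse_hull.rep_eq inv_elt_left_inverse_hull.rep_eq)
  qed
  show "b = inv_elt a" if 1: "a * b * a = a" and 2: "b * a * b = b"
  proof (rule pmap_inject[THEN iffD1], rule ext)
    have 3: "(pmap a \<circ>\<^sub>m pmap b) \<circ>\<^sub>m pmap a = pmap a" "(pmap b \<circ>\<^sub>m pmap a) \<circ>\<^sub>m pmap b = pmap b"
      using arg_cong[OF 1, of pmap] arg_cong[OF 2, of pmap]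
      by (simp_all add: times_left_inverse_hull.rep_eq)
    have A: "pmap b y = Some x" if ax: "pmap a x = Some y" for x y
    proof -
      have "((pmap a \<circ>\<^sub>m pmap b) \<circ>\<^sub>m pmap a) x = Some y" using 3 ax by simp
      then obtain z where z: "pmap b y = Some z" "pmap a z = Some y"
        using ax by (auto simp: map_comp_def split: option.splits)
      then have "z = x" using ax inj_pmap[of a] by (metis domI inj_on_def)
      with z show ?thesis by simp
    qed
    have B: "pmap a x = Some y" if bx: "pmap b y = Some x" for x y
    proof -
      have "((pmap b \<circ>\<^sub>m pmap a) \<circ>\<^sub>m pmap b) y = Some x" using 3 bx by simp
      then obtain z where z: "pmap a x = Some z" "pmap b z = Some x"
        using bx by (auto simp: map_comp_def split: option.splits)
      then have "z = y" using bx inj_pmap[of b] by (metis domI inj_on_def)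
      with z show ?thesis by simp
    qed
    show "pmap b y = pmap (inv_elt a) y" for y
      unfolding inv_elt_left_inverse_hull.rep_eq
      by (metis A B * not_Some_eq)
  qed
qed

end


section \<open>The regular representations\<close>

definition V_op :: "'a::left_cancel_monoid_mult \<Rightarrow> 'a op"
  where "V_op s = partial_op (lmult s)"

lemma V_op_ket: "blinfun_apply (V_op s) (ket t) = ket (s * t)"
  unfolding V_op_def partial_op_ket[OF inj_lmult] by (simp add: lmult_def)

definition omega :: "'a::left_cancel_monoid_mult left_inverse_hull \<Rightarrow> 'a op"
  where "omega f = partial_op (pmap f)"

lemma omega_ket:
  "blinfun_apply (omega f) (ket s) = (case pmap f s of None \<Rightarrow> 0 | Some t \<Rightarrow> ket t)"
  unfolding omega_def by (rule partial_op_ket[OF inj_pmap])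

definition Lambda :: "'p::inverse_semigroup \<Rightarrow> 'p op"
  where "Lambda p = partial_op (\<lambda>q. if inv_elt p * p * q = q then Some (p * q) else None)"

lemma Lambda_ket:
  "blinfun_apply (Lambda p) (ket q) = (if inv_elt p * p * q = q then ket (p * q) else 0)"
proof -
  let ?f = "\<lambda>q. if inv_elt p * p * q = q then Some (p * q) else None"
  have "inj_on ?f (dom ?f)"
    by (rule inj_onI) (auto split: if_splits, metis mult.assoc)
  then show ?thesis unfolding Lambda_def by (simp add: partial_op_ket)
qed


section \<open>The C*-algebras and their *-homomorphisms\<close>

record 'x star_algebra =
  alg_carrier :: "'x set"
  alg_add :: "'x \<Rightarrow> 'x \<Rightarrow> 'x"
  alg_mult :: "'x \<Rightarrow> 'x \<Rightarrow> 'x"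
  alg_scale :: "complex \<Rightarrow> 'x \<Rightarrow> 'x"
  alg_star :: "'x \<Rightarrow> 'x"

definition star_hom :: "'x star_algebra \<Rightarrow> 'y star_algebra \<Rightarrow> ('x \<Rightarrow> 'y) \<Rightarrow> bool"
  where "star_hom A B h \<longleftrightarrow> h \<in> alg_carrier A \<rightarrow> alg_carrier B \<and>
    (\<forall>x\<in>alg_carrier A. \<forall>y\<in>alg_carrier A. h (alg_add A x y) = alg_add B (h x) (h y)) \<and>
    (\<forall>x\<in>alg_carrier A. \<forall>y\<in>alg_carrier A. h (alg_mult A x y) = alg_mult B (h x) (h y)) \<and>
    (\<forall>c. \<forall>x\<in>alg_carrier A. h (alg_scale A c x) = alg_scale B c (h x)) \<and>
    (\<forall>x\<in>alg_carrier A. h (alg_star A x) = alg_star B (h x))"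

definition star_iso :: "'x star_algebra \<Rightarrow> 'y star_algebra \<Rightarrow> ('x \<Rightarrow> 'y) \<Rightarrow> bool"
  where "star_iso A B h \<longleftrightarrow> star_hom A B h \<and> bij_betw h (alg_carrier A) (alg_carrier B)"

definition op_algebra :: "'a op set \<Rightarrow> 'a op star_algebra"
  where "op_algebra A = \<lparr>alg_carrier = A, alg_add = (+), alg_mult = (o\<^sub>L),
    alg_scale = scale_op, alg_star = adj\<rparr>"

definition alg_coset :: "'x star_algebra \<Rightarrow> 'x set \<Rightarrow> 'x \<Rightarrow> 'x set"
  where "alg_coset A J x = alg_add A x ` J"

text \<open>As for rings, an operation on cosets is the union over all representatives of the cosets of
  the results; for an ideal \<open>J\<close> this union is a single coset.\<close>

definition quotient_algebra :: "'x star_algebra \<Rightarrow> 'x set \<Rightarrow> 'x set star_algebra"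
  where "quotient_algebra A J =
   \<lparr>alg_carrier = alg_coset A J ` alg_carrier A,
    alg_add = (\<lambda>X Y. \<Union>x\<in>X. \<Union>y\<in>Y. alg_coset A J (alg_add A x y)),
    alg_mult = (\<lambda>X Y. \<Union>x\<in>X. \<Union>y\<in>Y. alg_coset A J (alg_mult A x y)),
    alg_scale = (\<lambda>c X. \<Union>x\<in>X. alg_coset A J (alg_scale A c x)),
    alg_star = (\<lambda>X. \<Union>x\<in>X. alg_coset A J (alg_star A x))\<rparr>"

definition semigroup_cstar :: "'a::left_cancel_monoid_mult op star_algebra"
  where "semigroup_cstar = op_algebra (cstar_generated (range V_op))"

definition inverse_semigroup_cstar :: "'p::inverse_semigroup op star_algebra"
  where "inverse_semigroup_cstar = op_algebra (closure (cspan (range Lambda)))"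

text \<open>The complex multiples of \<open>Lambda 0\<close> if the hull contains the empty map \<open>0\<close>, and the zero ideal
  otherwise. In the latter case the quotient below consists of singletons and is a copy of
  \<open>inverse_semigroup_cstar\<close> itself.\<close>

definition zero_ideal :: "'a::left_cancel_monoid_mult left_inverse_hull op set"
  where "zero_ideal = (if Map.empty \<in> (hull_maps :: ('a \<rightharpoonup> 'a) set)
    then {scale_op c (Lambda (Abs_left_inverse_hull Map.empty)) | c. True} else {0})"

definition hull_cstar0 :: "'a::left_cancel_monoid_mult left_inverse_hull op set star_algebra"
  where "hull_cstar0 = quotient_algebra inverse_semigroup_cstar zero_ideal"

definition Lambda0 :: "'a::left_cancel_monoid_mult left_inverse_hull \<Rightarrow> 'a left_inverse_hull op set"
  where "Lambda0 f = alg_coset inverse_semigroup_cstar zero_ideal (Lambda f)"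

text \<open>Extensionality only normalises the values of \<open>h\<close> outside the carrier.\<close>

definition canonical_hom ::
  "('a::left_cancel_monoid_mult left_inverse_hull op set \<Rightarrow> 'a op) \<Rightarrow> bool"
  where "canonical_hom h \<longleftrightarrow> h \<in> extensional (alg_carrier hull_cstar0) \<and>
    star_hom hull_cstar0 semigroup_cstar h \<and> (\<forall>f. h (Lambda0 f) = omega f)"

end

(* For a nonzero idempotent e = 1_{tS} of the hull P, Clifford's condition identifies the elements of P
   with source e with the fractions lambda_s lambda_t^*, s in S, so that l2(P) splits into copies of
   l2(S), one for each principal right ideal tS, together with the line through the basis vector at 0.
   On every copy Lambda acts as omega, and on the line it acts as a character. Hence compression to
   the copy with t = 1 is a *-homomorphism of C*_r(P) carrying Lambda to omega. It is isometric on the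
   operators that vanish on the line, and Lambda(0) is the projection onto the line; so its kernel is
   C Lambda(0) and its range is closed. Uniqueness needs automatic continuity: if norm x is small, then
   1 - x^* x is the square of a self-adjoint element, so its image under a unital *-homomorphism is
   positive, which bounds the image of x. *)

theory Submission
  imports Defs
begin

section \<open>Completeness and the inner product\<close>

text \<open>Left multiplication by an element of the hull changes the numerator s of a fraction and
  keeps its denominator t. The copies are therefore reducing for \<open>Lambda\<close>, and one
  operator \<open>compress x\<close> serves for all of them; this makes compression multiplicative
  and lets its norm control x on every copy at once. The line at 0 is the only part that escapes
  this control. Each coset of the kernel is handled through its representative that vanishes on the
  line, so no quotient norm is introduced. Two obstacles shape the rest. \<open>adj\<close> is a
  definite description, so adjoints are exhibited for the generators and carried through spans and
  norm limits. And \<open>star_hom\<close> is purely algebraic, so agreement on the generators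
  settles equality only on their span; hence the detour through square roots, whose existence comes
  from a contraction rather than from spectral theory.\<close>

lemma cinner_add_left: "cinner (u + v) w = cinner u w + cinner v w"
  unfolding cinner_def infsum_add[OF cinner_summable cinner_summable, symmetric]
  by (simp add: plus_ell2.rep_eq algebra_simps)

lemma cinner_commute: "cinner v u = cnj (cinner u v)"
  unfolding cinner_def infsum_cnj[symmetric] by (simp add: mult.commute)

lemma cinner_add_right: "cinner w (u + v) = cinner w u + cinner w v"
  using cinner_commute[of w "u + v"] cinner_commute[of w u] cinner_commute[of w v]
  by (simp add: cinner_add_left)

lemma cinner_scaleC_right: "cinner v (c *\<^sub>C w) = c * cinner v w"
  unfolding cinner_def infsum_cmult_right'[symmetric]
  by (simp add: scaleC.rep_eq algebra_simps)

lemma cinner_scaleC_left: "cinner (c *\<^sub>C v) w = cnj c * cinner v w"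
  using cinner_commute[of "c *\<^sub>C v" w] cinner_commute[of v w] by (simp add: cinner_scaleC_right)

text \<open>Multiplying w by a unimodular c makes the inner product real and nonnegative, which
  reduces the complex inequality to the Cauchy-Schwarz inequality for the real part
  \<open>inner\<close>.\<close>

lemma cmod_cinner_le: "cmod (cinner v w) \<le> norm v * norm w"
proof (cases "cinner v w = 0")
  case False
  define c where "c = cnj (cinner v w) / cmod (cinner v w)"
  have c: "cmod c = 1" using False by (simp add: c_def norm_divide)
  have "c * cinner v w = cmod (cinner v w)"
    using False by (simp add: c_def complex_norm_square[symmetric] power2_eq_square mult.commute)
  then have "cmod (cinner v w) = inner v (c *\<^sub>C w)"
    by (simp add: inner_ell2_def cinner_scaleC_right)
  also have "\<dots> \<le> norm v * norm (c *\<^sub>C w)" by (rule norm_cauchy_schwarz)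
  finally show ?thesis using c by (simp add: norm_scaleC)
qed simp

lemma bounded_bilinear_cinner: "bounded_bilinear cinner"
proof
  show "\<exists>K. \<forall>a b :: 'a ell2. norm (cinner a b) \<le> norm a * norm b * K"
    by (rule exI[of _ 1]) (simp add: cmod_cinner_le)
qed (simp_all add: cinner_add_left cinner_add_right scaleR_ell2_def cinner_scaleC_left
    cinner_scaleC_right scaleR_conv_of_real)

interpretation cinner: bounded_bilinear cinner
  by (rule bounded_bilinear_cinner)

interpretation blinfun_comp: bounded_bilinear "(o\<^sub>L)"
  by (rule bounded_bilinear_blinfun_compose)

lemma cinner_eqI:
  assumes "\<And>w. cinner u w = cinner v w"
  shows "u = v"
proof -
  have "cinner (u - v) (u - v) = 0"
    by (simp add: cinner.diff_left assms)
  then have "inner (u - v) (u - v) = 0" by (simp add: inner_ell2_def)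
  then show ?thesis by simp
qed

lemma coord_add: "coord (v + w) i = coord v i + coord w i"
  by (simp add: plus_ell2.rep_eq)

lemma coord_diff: "coord (v - w) i = coord v i - coord w i"
  unfolding minus_ell2_def plus_ell2.rep_eq uminus_ell2.rep_eq by simp

lemma sum_coord_le_norm:
  assumes "finite F"
  shows "(\<Sum>i\<in>F. (cmod (coord v i))\<^sup>2) \<le> (norm v)\<^sup>2"
  unfolding norm_ell2_sq
  by (rule finite_sum_le_infsum) (use assms coord_summable in auto)

lemma cmod_coord_le: "cmod (coord v i) \<le> norm v"
  by (rule power2_le_imp_le) (use sum_coord_le_norm[of "{i}" v] in simp_all)

lemma bounded_linear_coord: "bounded_linear (\<lambda>v. coord v i)"
proof (rule bounded_linear_intro[where K=1])
  show "coord (x + y) i = coord x i + coord y i" for x y by (rule coord_add)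
  show "coord (r *\<^sub>R x) i = r *\<^sub>R coord x i" for r x
    by (simp add: scaleR_ell2_def scaleC.rep_eq scaleR_conv_of_real)
  show "norm (coord x i) \<le> norm x * 1" for x by (simp add: cmod_coord_le)
qed

text \<open>Bounds on finite partial sums survive coordinatewise limits, and they yield both
  square-summability of the limit and convergence in norm. Completeness passes to the operator
  spaces, where limits of adjoints, the fixed point argument and the closed range depend on
  it.\<close>

instance ell2 :: (type) banach
proof
  fix X :: "nat \<Rightarrow> 'a ell2"
  assume X: "Cauchy X"
  have "Cauchy (\<lambda>n. coord (X n) i)" for i
    by (rule bounded_linear.Cauchy[OF bounded_linear_coord[of i] X])
  then have "\<forall>i. \<exists>l. (\<lambda>n. coord (X n) i) \<longlonglongrightarrow> l"
    using Cauchy_convergent unfolding convergent_def by blast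
  then have "\<exists>l. \<forall>i. (\<lambda>n. coord (X n) i) \<longlonglongrightarrow> l i" by (rule choice)
  then obtain l where l: "\<And>i. (\<lambda>n. coord (X n) i) \<longlonglongrightarrow> l i" by blast
  have bound: "\<exists>N. \<forall>m\<ge>N. \<forall>F. finite F \<longrightarrow> (\<Sum>i\<in>F. (cmod (coord (X m) i - l i))\<^sup>2) \<le> e\<^sup>2"
    if "e > 0" for e :: real
  proof -
    obtain N where N: "\<And>m n. m \<ge> N \<Longrightarrow> n \<ge> N \<Longrightarrow> norm (X m - X n) < e"
      using CauchyD[OF X \<open>e > 0\<close>] by blast
    have "(\<Sum>i\<in>F. (cmod (coord (X m) i - l i))\<^sup>2) \<le> e\<^sup>2" if "m \<ge> N" "finite F" for m F
    proof (rule tendsto_upperbound)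
      show "(\<lambda>n. \<Sum>i\<in>F. (cmod (coord (X m) i - coord (X n) i))\<^sup>2)
          \<longlonglongrightarrow> (\<Sum>i\<in>F. (cmod (coord (X m) i - l i))\<^sup>2)"
        by (intro tendsto_intros l)
      show "\<forall>\<^sub>F n in sequentially. (\<Sum>i\<in>F. (cmod (coord (X m) i - coord (X n) i))\<^sup>2) \<le> e\<^sup>2"
        using eventually_ge_at_top[of N]
      proof eventually_elim
        case (elim n)
        have "(\<Sum>i\<in>F. (cmod (coord (X m) i - coord (X n) i))\<^sup>2) \<le> (norm (X m - X n))\<^sup>2"
          using sum_coord_le_norm[OF \<open>finite F\<close>, of "X m - X n"] by (simp add: coord_diff)
        also have "\<dots> \<le> e\<^sup>2"
          using N[OF \<open>m \<ge> N\<close> elim] by (intro power_mono) auto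
        finally show ?case .
      qed
    qed simp
    then show ?thesis by blast
  qed
  have summ: "(\<lambda>i. (cmod (d i))\<^sup>2) summable_on UNIV"
    if "\<And>F. finite F \<Longrightarrow> (\<Sum>i\<in>F. (cmod (d i))\<^sup>2) \<le> e\<^sup>2" for d :: "'a \<Rightarrow> complex" and e
    by (rule nonneg_bdd_above_summable_on) (use that in \<open>auto intro!: bdd_aboveI[of _ "e\<^sup>2"]\<close>)
  obtain m where m: "\<And>F. finite F \<Longrightarrow> (\<Sum>i\<in>F. (cmod (coord (X m) i - l i))\<^sup>2) \<le> 1\<^sup>2"
    using bound[of 1] by auto
  \<comment> \<open>The limit l is \<open>X m\<close> minus a difference already known to be
    square-summable.\<close>
  have "(\<lambda>i. (cmod (coord (X m) i + - (coord (X m) i - l i)))\<^sup>2) summable_on UNIV"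
    by (intro ell2_add_summable coord_summable) (use summ[OF m] in \<open>simp only: norm_minus_cancel\<close>)
  then have cL: "coord (Abs_ell2 l) = l" by (intro Abs_ell2_inverse) simp
  have "X \<longlonglongrightarrow> Abs_ell2 l"
  proof (rule LIMSEQ_I)
    fix r :: real assume "r > 0"
    then obtain N where N: "\<And>m F. m \<ge> N \<Longrightarrow> finite F \<Longrightarrow>
        (\<Sum>i\<in>F. (cmod (coord (X m) i - l i))\<^sup>2) \<le> (r/2)\<^sup>2"
      using bound[of "r/2"] by auto
    have "norm (X m - Abs_ell2 l) \<le> r/2" if "m \<ge> N" for m
    proof (rule power2_le_imp_le)
      show "(norm (X m - Abs_ell2 l))\<^sup>2 \<le> (r/2)\<^sup>2"
        unfolding norm_ell2_sq coord_diff cL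
        by (rule infsum_le_finite_sums) (use summ[OF N] N that in auto)
    qed (use \<open>r > 0\<close> in simp)
    then show "\<exists>no. \<forall>n\<ge>no. norm (X n - Abs_ell2 l) < r"
      using \<open>r > 0\<close> by (intro exI[of _ N]) fastforce
  qed
  then show "convergent X" by (rule convergentI)
qed

section \<open>Adjoints and C*-subalgebras spanned by a self-adjoint semigroup\<close>

text \<open>The relational form of adjointness: it can be verified for a proposed adjoint and
  combined algebraically, without an existence theorem behind \<open>adj\<close>.\<close>

definition is_adj :: "('a ell2 \<Rightarrow>\<^sub>L 'a ell2) \<Rightarrow> 'a op \<Rightarrow> bool"
  where "is_adj R T \<longleftrightarrow> (\<forall>v w. cinner (blinfun_apply R v) w = cinner v (blinfun_apply T w))"

lemma is_adjD: "is_adj R T \<Longrightarrow> cinner (blinfun_apply R v) w = cinner v (blinfun_apply T w)"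
  by (simp add: is_adj_def)

lemma is_adj_unique: "is_adj R T \<Longrightarrow> is_adj R' T \<Longrightarrow> R = R'"
  by (rule blinfun_eqI, rule cinner_eqI) (simp add: is_adjD)

lemma adj_eqI: "is_adj R T \<Longrightarrow> adj T = R"
  unfolding adj_def is_adj_def[symmetric] by (rule the_equality, assumption, rule is_adj_unique)

lemma is_adj_sym: "is_adj R T \<Longrightarrow> is_adj T R"
  unfolding is_adj_def
proof (intro allI)
  fix v w assume "\<forall>v w. cinner (blinfun_apply R v) w = cinner v (blinfun_apply T w)"
  then have "cinner (blinfun_apply R w) v = cinner w (blinfun_apply T v)" by blast
  then show "cinner (blinfun_apply T v) w = cinner v (blinfun_apply R w)"
    using cinner_commute[of "blinfun_apply T v" w] cinner_commute[of v "blinfun_apply R w"] by simp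
qed

section \<open>Calculus and norm of adjoint pairs\<close>

lemma is_adj_add: "is_adj R T \<Longrightarrow> is_adj R' T' \<Longrightarrow> is_adj (R + R') (T + T')"
  by (simp add: is_adj_def blinfun.add_left cinner_add_left cinner_add_right)

lemma is_adj_diff: "is_adj R T \<Longrightarrow> is_adj R' T' \<Longrightarrow> is_adj (R - R') (T - T')"
  by (simp add: is_adj_def blinfun.diff_left cinner.diff_left cinner.diff_right)

lemma is_adj_scale: "is_adj R T \<Longrightarrow> is_adj (scale_op (cnj c) R) (scale_op c T)"
  by (simp add: is_adj_def scale_op_apply cinner_scaleC_left cinner_scaleC_right)

lemma is_adj_compose: "is_adj R T \<Longrightarrow> is_adj R' T' \<Longrightarrow> is_adj (R' o\<^sub>L R) (T o\<^sub>L T')"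
  by (simp add: is_adj_def)

lemma is_adj_zero: "is_adj 0 0"
  by (simp add: is_adj_def cinner.zero_left cinner.zero_right)

lemma is_adj_id: "is_adj id_blinfun id_blinfun"
  by (simp add: is_adj_def)

text \<open>From |Rv|^2 = Re <v, T R v> comes |Rv|^2 \<le> |v| |T| |Rv|, and one factor cancels. By
  symmetry adjunction is isometric, which is what lets adjoints pass to norm limits.\<close>

lemma norm_is_adj_le:
  assumes "is_adj R T"
  shows "norm R \<le> norm T"
proof (rule norm_blinfun_bound)
  fix v
  have "(norm (R v))\<^sup>2 = Re (cinner v (T (R v)))"
    by (simp add: power2_norm_eq_inner inner_ell2_def is_adjD[OF assms])
  also have "\<dots> \<le> norm v * norm (T (R v))"
    using complex_Re_le_cmod cmod_cinner_le order_trans by blast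
  also have "\<dots> \<le> norm v * (norm T * norm (R v))"
    by (intro mult_left_mono norm_blinfun) auto
  finally have "norm (R v) * norm (R v) \<le> (norm T * norm v) * norm (R v)"
    by (simp add: power2_eq_square algebra_simps)
  then show "norm (R v) \<le> norm T * norm v"
    by (cases "norm (R v) = 0") (simp, simp add: mult_le_cancel_right)
qed simp

lemma norm_is_adj: "is_adj R T \<Longrightarrow> norm R = norm T"
  using norm_is_adj_le[of R T] norm_is_adj_le[of T R] is_adj_sym[of R T] by simp

lemma norm_scale_op: "norm (scale_op c T) \<le> cmod c * norm T"
  by (rule norm_blinfun_bound)
    (use norm_blinfun[of T] in \<open>auto simp: scale_op_apply norm_scaleC mult.assoc intro: mult_left_mono\<close>)

lemma scaleR_conv_scale_op: "r *\<^sub>R T = scale_op (complex_of_real r) T" for T :: "'a op"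
  by (rule blinfun_eqI) (simp add: scale_op_apply blinfun.scaleR_left scaleR_ell2_def)

lemma bounded_linear_scale_op: "bounded_linear (scale_op c)"
  by (rule bounded_linear_intro[where K="cmod c"])
    (simp_all add: op.scale_right_distrib scaleR_conv_scale_op mult.commute norm_scale_op)

lemma scale_op_compose_left: "scale_op c T o\<^sub>L R = scale_op c (T o\<^sub>L R)"
  by (rule blinfun_eqI) (simp add: scale_op_apply)

lemma scale_op_compose_right: "T \<in> clinear_ops \<Longrightarrow> T o\<^sub>L scale_op c R = scale_op c (T o\<^sub>L R)"
  by (rule blinfun_eqI) (simp add: scale_op_apply clinear_ops_def)

text \<open>A closed complex subspace containing X contains its closed span. As an induction rule
  this carries properties of the generators to the whole C*-algebra.\<close>

lemma closure_cspan_induct [consumes 1, case_names closed zero add scale base]: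
  assumes "T \<in> closure (cspan X)"
    and "closed {T. P T}"
    and "P 0" "\<And>T R. P T \<Longrightarrow> P R \<Longrightarrow> P (T + R)" "\<And>c T. P T \<Longrightarrow> P (scale_op c T)"
    and "\<And>T. T \<in> X \<Longrightarrow> P T"
  shows "P T"
proof -
  have "P T" if "T \<in> cspan X" for T
    using that
  proof (induction rule: op.span_induct_alt)
    case (step c x y)
    then show ?case by (blast intro: assms(4-6))
  qed fact
  then have "closure (cspan X) \<subseteq> {T. P T}"
    by (intro closure_minimal) (use assms in auto)
  with assms(1) show ?thesis by blast
qed

lemma closed_clinear_ops: "closed (clinear_ops :: 'a op set)"
proof -
  have "clinear_ops = (\<Inter>c v. {T :: 'a op. blinfun_apply T (c *\<^sub>C v) = blinfun_apply (scalar_op c) (blinfun_apply T v)})"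
    by (auto simp: clinear_ops_def scalar_op.rep_eq)
  also have "closed \<dots>"
    by (intro closed_INT ballI closed_Collect_eq continuous_intros)
  finally show ?thesis .
qed

lemma clinear_ops_zero: "0 \<in> clinear_ops"
  by (simp add: clinear_ops_def) (transfer, simp)

lemma scaleC_add_right: "c *\<^sub>C (v + w) = c *\<^sub>C v + c *\<^sub>C w"
  by transfer (simp add: algebra_simps)

lemma clinear_ops_add: "T \<in> clinear_ops \<Longrightarrow> R \<in> clinear_ops \<Longrightarrow> T + R \<in> clinear_ops"
  by (simp add: clinear_ops_def blinfun.add_left scaleC_add_right)

lemma clinear_ops_scale: "T \<in> clinear_ops \<Longrightarrow> scale_op c T \<in> clinear_ops"
  by (simp add: clinear_ops_def scale_op_apply) (transfer, simp add: algebra_simps)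

text \<open>When the generators are closed under products and adjoints, their linear span is already
  a *-algebra, so its closure is a C*-algebra. Both \<open>range omega\<close> and
  \<open>range Lambda\<close> are of this kind.\<close>

locale star_semigroup =
  fixes X :: "'a op set"
  assumes clinear: "X \<subseteq> clinear_ops"
    and compose: "T \<in> X \<Longrightarrow> R \<in> X \<Longrightarrow> T o\<^sub>L R \<in> X"
    and ex_adj: "T \<in> X \<Longrightarrow> \<exists>R\<in>X. is_adj R T"
begin

lemma ccspan_add: "T \<in> closure (cspan X) \<Longrightarrow> R \<in> closure (cspan X) \<Longrightarrow> T + R \<in> closure (cspan X)"
  unfolding closure_sequential
proof (elim exE conjE)
  fix f g assume "\<forall>n. f n \<in> cspan X" "f \<longlonglongrightarrow> T" "\<forall>n. g n \<in> cspan X" "g \<longlonglongrightarrow> R"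
  then show "\<exists>x. (\<forall>n. x n \<in> cspan X) \<and> x \<longlonglongrightarrow> T + R"
    by (intro exI[of _ "\<lambda>n. f n + g n"]) (simp add: tendsto_add op.span_add)
qed

lemma ccspan_scale: "T \<in> closure (cspan X) \<Longrightarrow> scale_op c T \<in> closure (cspan X)"
  unfolding closure_sequential
proof (elim exE conjE)
  fix f assume f: "\<forall>n. f n \<in> cspan X" "f \<longlonglongrightarrow> T"
  have "(\<lambda>n. scale_op c (f n)) \<longlonglongrightarrow> scale_op c T"
    by (rule bounded_linear.tendsto[OF bounded_linear_scale_op f(2)])
  then show "\<exists>x. (\<forall>n. x n \<in> cspan X) \<and> x \<longlonglongrightarrow> scale_op c T"
    using f(1) by (intro exI[of _ "\<lambda>n. scale_op c (f n)"]) (simp add: op.span_scale)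
qed

lemma ccspan_base: "T \<in> X \<Longrightarrow> T \<in> closure (cspan X)"
  using closure_subset op.span_base by blast

lemma ccspan_zero: "0 \<in> closure (cspan X)"
  using closure_subset op.span_zero by blast

lemma ccspan_clinear: "T \<in> closure (cspan X) \<Longrightarrow> T \<in> clinear_ops"
  by (induction rule: closure_cspan_induct)
    (use clinear in \<open>auto simp: closed_clinear_ops clinear_ops_zero clinear_ops_add clinear_ops_scale\<close>)

lemma ccspan_compose:
  assumes "T \<in> closure (cspan X)" "R \<in> closure (cspan X)"
  shows "T o\<^sub>L R \<in> closure (cspan X)"
proof -
  \<comment> \<open>One factor is treated at a time. For a generator T, complex linearity is at
    hand, which is needed to pull scalars out of the right factor.\<close>
  have *: "T o\<^sub>L R \<in> closure (cspan X)" if "T \<in> X" for T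
    using assms(2)
  proof (induction rule: closure_cspan_induct)
    case closed
    show ?case
      by (rule closed_vimage[of "closure (cspan X)" "\<lambda>R. T o\<^sub>L R", unfolded vimage_def])
        (auto intro!: continuous_intros)
  next
    case (scale c R)
    have "T \<in> clinear_ops" using clinear that by blast
    then show ?case using ccspan_scale[OF scale] by (simp add: scale_op_compose_right)
  qed (simp_all add: ccspan_zero ccspan_add blinfun_comp.add_right blinfun_comp.zero_right
      ccspan_base compose that)
  show ?thesis
    using assms(1)
  proof (induction rule: closure_cspan_induct)
    case closed
    show ?case
      by (rule closed_vimage[of "closure (cspan X)" "\<lambda>T. T o\<^sub>L R", unfolded vimage_def])
        (auto intro!: continuous_intros)
  qed (simp_all add: ccspan_zero ccspan_add blinfun_comp.add_left blinfun_comp.zero_left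
      ccspan_scale scale_op_compose_left *)
qed

lemma ccspan_ex_adj:
  assumes "T \<in> closure (cspan X)"
  shows "\<exists>R \<in> closure (cspan X). is_adj R T"
  using assms
proof (induction rule: closure_cspan_induct)
  case closed
  show ?case
    unfolding closed_sequential_limits
  proof (intro allI impI, elim conjE)
    fix f :: "nat \<Rightarrow> 'a op" and T
    assume f: "\<forall>n. f n \<in> {T. \<exists>R\<in>closure (cspan X). is_adj R T}" and lim: "f \<longlonglongrightarrow> T"
    then have "\<exists>g. \<forall>n. g n \<in> closure (cspan X) \<and> is_adj (g n) (f n)"
      by (intro choice) blast
    then obtain g where g: "\<And>n. g n \<in> closure (cspan X)" "\<And>n. is_adj (g n) (f n)" by blast
    \<comment> \<open>Differences of adjoints are adjoints of differences, so isometry of adjunction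
      makes the sequence g Cauchy along with f.\<close>
    have "norm (g m - g n) = norm (f m - f n)" for m n
      by (rule norm_is_adj) (intro is_adj_diff g)
    moreover have "Cauchy f" using lim by (rule LIMSEQ_imp_Cauchy)
    ultimately have "Cauchy g" by (simp add: Cauchy_iff)
    then obtain R where R: "g \<longlonglongrightarrow> R" by (metis Cauchy_convergent convergent_def)
    have "R \<in> closure (cspan X)"
      using closed_sequentially[OF closed_closure g(1) R] .
    moreover have "is_adj R T"
      unfolding is_adj_def
    proof (intro allI)
      fix v w
      have "(\<lambda>n. cinner (blinfun_apply (g n) v) w) \<longlonglongrightarrow> cinner (blinfun_apply R v) w"
        by (intro cinner.tendsto tendsto_intros R)
      moreover have "(\<lambda>n. cinner v (blinfun_apply (f n) w)) \<longlonglongrightarrow> cinner v (blinfun_apply T w)"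
        by (intro cinner.tendsto tendsto_intros lim)
      ultimately show "cinner (blinfun_apply R v) w = cinner v (blinfun_apply T w)"
        by (simp add: is_adjD[OF g(2)] LIMSEQ_unique)
    qed
    ultimately show "T \<in> {T. \<exists>R\<in>closure (cspan X). is_adj R T}" by blast
  qed
next
  case zero
  show ?case using is_adj_zero ccspan_zero by blast
next
  case (add T R)
  then show ?case using is_adj_add ccspan_add by blast
next
  case (scale c T)
  then show ?case using is_adj_scale ccspan_scale by blast
next
  case (base T)
  then show ?case using ex_adj ccspan_base by blast
qed

lemma adj_ccspan:
  assumes "T \<in> closure (cspan X)"
  shows "is_adj (adj T) T" "adj T \<in> closure (cspan X)"
proof -
  obtain R where R: "R \<in> closure (cspan X)" "is_adj R T"
    using ccspan_ex_adj[OF assms] by (rule bexE)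
  have "adj T = R" using R(2) by (rule adj_eqI)
  with R show "is_adj (adj T) T" "adj T \<in> closure (cspan X)" by simp_all
qed

lemma cstar_subalgebra_ccspan: "cstar_subalgebra (closure (cspan X))"
  unfolding cstar_subalgebra_def
proof (intro conjI ballI allI subsetI)
  fix T c assume T: "T \<in> closure (cspan X)"
  show "T \<in> clinear_ops" "scale_op c T \<in> closure (cspan X)" "adj T \<in> closure (cspan X)"
    by (fact ccspan_clinear[OF T] ccspan_scale[OF T] adj_ccspan(2)[OF T])+
  fix R assume R: "R \<in> closure (cspan X)"
  show "T + R \<in> closure (cspan X)" "T o\<^sub>L R \<in> closure (cspan X)"
    by (fact ccspan_add[OF T R] ccspan_compose[OF T R])+
qed (rule closed_closure ccspan_zero)+

end

section \<open>Star homomorphisms of operator algebras\<close>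

lemma star_hom_opD:
  assumes "star_hom (op_algebra A) (op_algebra B) \<phi>"
  shows "x \<in> A \<Longrightarrow> \<phi> x \<in> B"
    and "x \<in> A \<Longrightarrow> y \<in> A \<Longrightarrow> \<phi> (x + y) = \<phi> x + \<phi> y"
    and "x \<in> A \<Longrightarrow> y \<in> A \<Longrightarrow> \<phi> (x o\<^sub>L y) = \<phi> x o\<^sub>L \<phi> y"
    and "x \<in> A \<Longrightarrow> \<phi> (scale_op c x) = scale_op c (\<phi> x)"
    and "x \<in> A \<Longrightarrow> \<phi> (adj x) = adj (\<phi> x)"
  using assms by (auto simp: star_hom_def op_algebra_def)

lemma cstar_subalgebraD:
  assumes "cstar_subalgebra A"
  shows "closed A" "0 \<in> A" "x \<in> A \<Longrightarrow> y \<in> A \<Longrightarrow> x + y \<in> A" "x \<in> A \<Longrightarrow> scale_op c x \<in> A"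
    "x \<in> A \<Longrightarrow> y \<in> A \<Longrightarrow> x o\<^sub>L y \<in> A" "x \<in> A \<Longrightarrow> adj x \<in> A"
  using assms by (auto simp: cstar_subalgebra_def)

lemma cstar_subalgebra_diff:
  assumes "cstar_subalgebra A" "x \<in> A" "y \<in> A"
  shows "x - y \<in> A"
proof -
  have "x + scale_op (-1) y \<in> A"
    using assms by (intro cstar_subalgebraD)
  then show ?thesis by (simp add: op.scale_minus_left)
qed

lemma star_hom_op_diff:
  assumes "star_hom (op_algebra A) (op_algebra B) \<phi>" "cstar_subalgebra A" "x \<in> A" "y \<in> A"
  shows "\<phi> (x - y) = \<phi> x - \<phi> y"
proof -
  have "scale_op (-1) y \<in> A" using assms by (intro cstar_subalgebraD)
  then have "\<phi> (x + scale_op (-1) y) = \<phi> x + scale_op (-1) (\<phi> y)"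
    using star_hom_opD(2)[OF assms(1,3), of "scale_op (-1) y"] star_hom_opD(4)[OF assms(1,4)]
    by metis
  then show ?thesis by (simp add: op.scale_minus_left)
qed

section \<open>Automatic continuity of unital *-homomorphisms\<close>

lemma closed_self_adjoint: "closed {w. is_adj w w}"
  unfolding is_adj_def
  by (intro closed_Collect_all closed_Collect_eq cinner.continuous_on continuous_intros)

text \<open>If \<open>w\<close> is a fixed point of \<open>w \<mapsto> (a + w\<^sup>2) / 2\<close>, then \<open>1 - w\<close> is a square root of \<open>1 - a\<close>.\<close>

lemma ex_self_adjoint_sqrt:
  assumes A: "cstar_subalgebra A" and a: "a \<in> A" "is_adj a a" "norm a \<le> 3/4"
  obtains w where "w \<in> A" "is_adj w w"
    "(id_blinfun - w) o\<^sub>L (id_blinfun - w) = id_blinfun - a"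
proof -
  \<comment> \<open>On the ball of radius 1/2 the iteration has norm at most (3/4 + 1/4) / 2 = 1/2
    and Lipschitz constant at most (1/2 + 1/2) / 2 = 1/2; this matches the bound 3/4 on a.
    Restricting to self-adjoint elements of A places the fixed point there too.\<close>
  define S where "S = A \<inter> {w. is_adj w w} \<inter> cball 0 (1/2)"
  define F where "F w = (1/2) *\<^sub>R (a + (w o\<^sub>L w))" for w
  have "closed S"
    unfolding S_def using cstar_subalgebraD(1)[OF A] closed_self_adjoint by (intro closed_Int) auto
  then have "complete S" by (simp add: complete_eq_closed)
  moreover have "0 \<in> S"
    using cstar_subalgebraD(2)[OF A] is_adj_zero by (simp add: S_def)
  moreover have "F ` S \<subseteq> S"
  proof (rule image_subsetI)
    fix w assume "w \<in> S"
    then have w: "w \<in> A" "is_adj w w" "norm w \<le> 1/2" by (auto simp: S_def)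
    have "F w \<in> A"
      unfolding F_def scaleR_conv_scale_op using a(1) w(1)
      by (intro cstar_subalgebraD[OF A])
    moreover have "is_adj (scale_op (cnj (of_real (1/2))) (a + (w o\<^sub>L w))) (F w)"
      unfolding F_def scaleR_conv_scale_op by (intro is_adj_scale is_adj_add is_adj_compose a w)
    then have "is_adj (F w) (F w)" by (simp add: F_def scaleR_conv_scale_op)
    moreover have "norm (F w) \<le> 1/2"
    proof -
      have "norm (w o\<^sub>L w) \<le> norm w * norm w" by (rule norm_blinfun_compose)
      also have "\<dots> \<le> 1/2 * (1/2)" by (intro mult_mono w) auto
      finally have "norm (a + (w o\<^sub>L w)) \<le> 1"
        using norm_triangle_ineq[of a "w o\<^sub>L w"] a(3) by simp
      then show ?thesis by (simp add: F_def)
    qed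
    ultimately show "F w \<in> S" by (simp add: S_def)
  qed
  moreover have "dist (F w) (F z) \<le> 1/2 * dist w z" if "w \<in> S" "z \<in> S" for w z
  proof -
    have n: "norm w \<le> 1/2" "norm z \<le> 1/2" using that by (auto simp: S_def)
    \<comment> \<open>The noncommutative telescoping w w - z z = w (w - z) + (w - z) z.\<close>
    have "F w - F z = (1/2) *\<^sub>R ((w o\<^sub>L (w - z)) + ((w - z) o\<^sub>L z))"
      unfolding F_def scaleR_diff_right[symmetric]
      by (simp add: blinfun_comp.diff_left blinfun_comp.diff_right)
    then have "norm (F w - F z) = norm ((w o\<^sub>L (w - z)) + ((w - z) o\<^sub>L z)) / 2" by simp
    also have "\<dots> \<le> (norm w * norm (w - z) + norm (w - z) * norm z) / 2"
      by (intro divide_right_mono norm_triangle_mono norm_blinfun_compose) auto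
    also have "\<dots> = ((norm w + norm z) * norm (w - z)) / 2" by (simp add: algebra_simps)
    also have "\<dots> \<le> (1 * norm (w - z)) / 2"
      using n by (intro divide_right_mono mult_right_mono) auto
    finally show ?thesis by (simp add: dist_norm)
  qed
  ultimately obtain w where "w \<in> S" "F w = w"
    using Banach_fix[of S "1/2" F] by auto
  then have w: "w \<in> A" "is_adj w w" "F w = w" by (auto simp: S_def)
  have "2 *\<^sub>R F w = 2 *\<^sub>R w" using w(3) by simp
  then have ww: "w o\<^sub>L w = w + w - a" by (simp add: F_def scaleR_2 eq_diff_eq add.commute)
  have "(id_blinfun - w) o\<^sub>L (id_blinfun - w) = id_blinfun - w - w + (w o\<^sub>L w)"
    by (rule blinfun_eqI) (simp add: blinfun.diff_left blinfun.diff_right blinfun.add_left)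
  then show ?thesis using w by (intro that) (simp_all add: ww)
qed

text \<open>\<open>A_adj\<close> and \<open>B_adj\<close> are stated separately because
  \<open>cstar_subalgebra\<close> records only that \<open>adj x\<close> lies in the algebra, not
  that it satisfies the adjoint identity.\<close>

locale unital_star_hom =
  fixes A :: "'a op set" and B :: "'b op set" and \<phi>
  assumes A: "cstar_subalgebra A" and A_adj: "\<And>x. x \<in> A \<Longrightarrow> is_adj (adj x) x"
    and A_id: "id_blinfun \<in> A"
    and B_adj: "\<And>y. y \<in> B \<Longrightarrow> is_adj (adj y) y"
    and hom: "star_hom (op_algebra A) (op_algebra B) \<phi>" and \<phi>_id: "\<phi> id_blinfun = id_blinfun"
begin

text \<open>With \<open>1 - x\<^sup>* x = b\<^sup>2\<close> and \<open>b\<close> self-adjoint, \<open>1 - \<phi>(x)\<^sup>* \<phi>(x) = \<phi>(b)\<^sup>2 \<ge> 0\<close>.\<close>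

lemma norm_hom_le_1:
  assumes x: "x \<in> A" "norm x \<le> 1/2"
  shows "norm (\<phi> x) \<le> 1"
proof -
  let ?a = "adj x o\<^sub>L x"
  have "norm ?a \<le> norm (adj x) * norm x" by (rule norm_blinfun_compose)
  also have "\<dots> = norm x * norm x" by (simp add: norm_is_adj[OF A_adj[OF x(1)]])
  also have "\<dots> \<le> 1/2 * (1/2)" using x(2) by (intro mult_mono) auto
  finally have "norm ?a \<le> 3/4" by simp
  moreover have a: "?a \<in> A" using x by (intro cstar_subalgebraD[OF A])
  moreover have "is_adj ?a ?a"
    using is_adj_compose[OF is_adj_sym[OF A_adj[OF x(1)]] A_adj[OF x(1)]] .
  ultimately obtain w where w: "w \<in> A" "is_adj w w"
    "(id_blinfun - w) o\<^sub>L (id_blinfun - w) = id_blinfun - ?a"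
    using ex_self_adjoint_sqrt[OF A] by blast
  define b where "b = id_blinfun - w"
  have b: "b \<in> A" unfolding b_def using A A_id w(1) by (rule cstar_subalgebra_diff)
  have "is_adj b b" unfolding b_def by (intro is_adj_diff is_adj_id w)
  then have "adj b = b" by (rule adj_eqI)
  \<comment> \<open>Preservation of \<open>adj\<close> transfers self-adjointness from b to \<phi>
    b, so the square of \<phi> b is a positive operator.\<close>
  then have "adj (\<phi> b) = \<phi> b" using star_hom_opD(5)[OF hom b] by simp
  then have b_adj: "is_adj (\<phi> b) (\<phi> b)" using B_adj[of "\<phi> b"] star_hom_opD(1)[OF hom b] by simp
  have x_adj: "is_adj (adj (\<phi> x)) (\<phi> x)" using B_adj star_hom_opD(1)[OF hom x(1)] by blast
  have "\<phi> b o\<^sub>L \<phi> b = \<phi> (id_blinfun - ?a)"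
    using star_hom_opD(3)[OF hom b b] w(3) by (simp add: b_def)
  also have "\<dots> = id_blinfun - (adj (\<phi> x) o\<^sub>L \<phi> x)"
    using star_hom_op_diff[OF hom A A_id a] star_hom_opD(3)[OF hom cstar_subalgebraD(6)[OF A x(1)] x(1)]
      star_hom_opD(5)[OF hom x(1)] \<phi>_id by simp
  finally have eq: "\<phi> b o\<^sub>L \<phi> b = id_blinfun - (adj (\<phi> x) o\<^sub>L \<phi> x)" .
  show ?thesis
  proof (rule norm_blinfun_bound)
    fix v
    have "cinner v ((\<phi> b o\<^sub>L \<phi> b) v) = cinner v v - cinner v (adj (\<phi> x) (\<phi> x v))"
      by (simp add: eq blinfun.diff_left cinner.diff_right)
    then have "cinner (\<phi> b v) (\<phi> b v) = cinner v v - cinner (\<phi> x v) (\<phi> x v)"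
      using is_adjD[OF b_adj, of v "\<phi> b v"] is_adjD[OF is_adj_sym[OF x_adj], of v "\<phi> x v"] by simp
    then have "(norm (\<phi> b v))\<^sup>2 = (norm v)\<^sup>2 - (norm (\<phi> x v))\<^sup>2"
      by (simp add: power2_norm_eq_inner inner_ell2_def)
    then have "(norm (\<phi> x v))\<^sup>2 \<le> (norm v)\<^sup>2"
      using zero_le_power2[of "norm (\<phi> b v)"] by linarith
    then show "norm (\<phi> x v) \<le> 1 * norm v"
      using power2_le_imp_le by simp
  qed simp
qed

text \<open>Rescaling x to norm 1/2 turns the bound on that ball into a Lipschitz bound; the
  constant 2 is the inverse of the radius.\<close>

lemma norm_hom_le:
  assumes "x \<in> A"
  shows "norm (\<phi> x) \<le> 2 * norm x"
proof (cases "x = 0")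
  case True
  then show ?thesis using star_hom_op_diff[OF hom A assms assms] by simp
next
  case False
  let ?c = "1 / (2 * norm x)"
  have "norm (\<phi> (?c *\<^sub>R x)) \<le> 1"
  proof (rule norm_hom_le_1)
    show "?c *\<^sub>R x \<in> A"
      unfolding scaleR_conv_scale_op using A assms by (rule cstar_subalgebraD(4))
  qed (use False in simp)
  moreover have "\<phi> (?c *\<^sub>R x) = ?c *\<^sub>R \<phi> x"
    unfolding scaleR_conv_scale_op using assms by (rule star_hom_opD[OF hom])
  ultimately show ?thesis using False by (simp add: field_simps)
qed

lemma tendsto_hom:
  assumes "\<And>n. f n \<in> A" "x \<in> A" "f \<longlonglongrightarrow> x"
  shows "(\<lambda>n. \<phi> (f n)) \<longlonglongrightarrow> \<phi> x"
proof (rule LIM_zero_cancel, rule Lim_null_comparison)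
  show "\<forall>\<^sub>F n in sequentially. norm (\<phi> (f n) - \<phi> x) \<le> 2 * norm (f n - x)"
  proof (rule always_eventually, rule allI)
    fix n
    show "norm (\<phi> (f n) - \<phi> x) \<le> 2 * norm (f n - x)"
      using norm_hom_le[OF cstar_subalgebra_diff[OF A assms(1,2)]] star_hom_op_diff[OF hom A assms(1,2)]
      by simp
  qed
  have "(\<lambda>n. norm (f n - x)) \<longlonglongrightarrow> 0"
    by (intro tendsto_norm_zero LIM_zero assms(3))
  then show "(\<lambda>n. 2 * norm (f n - x)) \<longlonglongrightarrow> 0" by (rule tendsto_mult_right_zero)
qed

end

lemma unital_star_hom_eqI:
  assumes "unital_star_hom (closure (cspan X)) B \<phi>" "unital_star_hom (closure (cspan X)) B \<psi>"
    and "\<And>x. x \<in> X \<Longrightarrow> \<phi> x = \<psi> x" and "x \<in> closure (cspan X)"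
  shows "\<phi> x = \<psi> x"
proof -
  interpret \<phi>: unital_star_hom "closure (cspan X)" B \<phi> by fact
  interpret \<psi>: unital_star_hom "closure (cspan X)" B \<psi> by fact
  let ?A = "closure (cspan X)"
  note hom = star_hom_opD[OF \<phi>.hom] star_hom_opD[OF \<psi>.hom]
  \<comment> \<open>Membership is carried along in the induction because the homomorphism laws hold
    only on the carrier.\<close>
  have "x \<in> ?A \<and> \<phi> x = \<psi> x"
    using assms(4)
  proof (induction rule: closure_cspan_induct)
    case closed
    show ?case
      unfolding closed_sequential_limits
    proof (intro allI impI, elim conjE)
      fix f x assume f: "\<forall>n. f n \<in> {T. T \<in> ?A \<and> \<phi> T = \<psi> T}" and lim: "f \<longlonglongrightarrow> x"
      have x: "x \<in> ?A" by (rule closed_sequentially[OF closed_closure _ lim]) (use f in auto)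
      have "(\<lambda>n. \<phi> (f n)) \<longlonglongrightarrow> \<phi> x" by (rule \<phi>.tendsto_hom) (use f x lim in auto)
      moreover have "(\<lambda>n. \<psi> (f n)) \<longlonglongrightarrow> \<psi> x" by (rule \<psi>.tendsto_hom) (use f x lim in auto)
      moreover have "(\<lambda>n. \<phi> (f n)) = (\<lambda>n. \<psi> (f n))" using f by auto
      ultimately show "x \<in> {T. T \<in> ?A \<and> \<phi> T = \<psi> T}"
        using x LIMSEQ_unique by auto
    qed
  next
    case zero
    have "0 \<in> ?A" by (rule cstar_subalgebraD(2)[OF \<phi>.A])
    then show ?case
      using star_hom_op_diff[OF \<phi>.hom \<phi>.A, of 0 0] star_hom_op_diff[OF \<psi>.hom \<psi>.A, of 0 0] by simp
  next
    case (add T R)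
    then show ?case using cstar_subalgebraD(3)[OF \<phi>.A, of T R] by (simp add: hom)
  next
    case (scale c T)
    then show ?case using cstar_subalgebraD(4)[OF \<phi>.A, of T c] by (simp add: hom)
  next
    case (base T)
    then have "T \<in> cspan X" by (rule op.span_base)
    with base show ?case using closure_subset assms(3) by blast
  qed
  then show ?thesis ..
qed

section \<open>Quotients by kernels\<close>

text \<open>The setting of the first isomorphism theorem: J is the kernel of a surjection \<phi>,
  and the quotient is identified with B algebraically.\<close>

locale surj_star_hom =
  fixes A :: "'a op set" and B :: "'b op set" and \<phi> J
  assumes A: "cstar_subalgebra A"
    and hom: "star_hom (op_algebra A) (op_algebra B) \<phi>" and surj: "\<phi> ` A = B"
    and J: "J = {x \<in> A. \<phi> x = 0}"
begin

text \<open>Two elements differ by an element of the kernel exactly when \<phi> agrees on them.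
  Well-definedness on cosets thus reduces to comparing values of \<phi>.\<close>

lemma coset_eq:
  assumes "x \<in> A"
  shows "alg_coset (op_algebra A) J x = {y \<in> A. \<phi> y = \<phi> x}"
proof (intro set_eqI iffI)
  fix y assume "y \<in> alg_coset (op_algebra A) J x"
  then obtain k where "k \<in> A" "\<phi> k = 0" "y = x + k"
    by (auto simp: alg_coset_def op_algebra_def J)
  then show "y \<in> {y \<in> A. \<phi> y = \<phi> x}"
    using assms by (simp add: star_hom_opD[OF hom] cstar_subalgebraD(3)[OF A])
next
  fix y assume "y \<in> {y \<in> A. \<phi> y = \<phi> x}"
  then have y: "y \<in> A" "\<phi> y = \<phi> x" by auto
  then have "y - x \<in> J"
    using assms by (simp add: J cstar_subalgebra_diff[OF A] star_hom_op_diff[OF hom A])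
  moreover have "y = x + (y - x)" by simp
  ultimately show "y \<in> alg_coset (op_algebra A) J x"
    unfolding alg_coset_def op_algebra_def by force
qed

lemma coset_eqI: "x \<in> A \<Longrightarrow> y \<in> A \<Longrightarrow> \<phi> x = \<phi> y \<Longrightarrow>
    alg_coset (op_algebra A) J x = alg_coset (op_algebra A) J y"
  by (simp add: coset_eq)

lemma mem_coset: "x \<in> A \<Longrightarrow> x \<in> alg_coset (op_algebra A) J x"
  by (simp add: coset_eq)

text \<open>Each union in the quotient operations ranges over equal cosets, and over a nonempty
  family since x represents its own coset; so it collapses to a single coset.\<close>

lemma star_hom_coset:
  "star_hom (op_algebra A) (quotient_algebra (op_algebra A) J) (alg_coset (op_algebra A) J)"
proof -
  let ?q = "alg_coset (op_algebra A) J"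
  have add: "(\<Union>x'\<in>?q x. \<Union>y'\<in>?q y. ?q (x' + y')) = ?q (x + y)" if "x \<in> A" "y \<in> A" for x y
  proof -
    have "?q (x' + y') = ?q (x + y)" if "x' \<in> ?q x" "y' \<in> ?q y" for x' y'
      using that \<open>x \<in> A\<close> \<open>y \<in> A\<close>
      by (intro coset_eqI) (auto simp: coset_eq star_hom_opD[OF hom] intro: cstar_subalgebraD(3)[OF A])
    then show ?thesis using mem_coset[OF that(1)] mem_coset[OF that(2)] by blast
  qed
  have mult: "(\<Union>x'\<in>?q x. \<Union>y'\<in>?q y. ?q (x' o\<^sub>L y')) = ?q (x o\<^sub>L y)" if "x \<in> A" "y \<in> A" for x y
  proof -
    have "?q (x' o\<^sub>L y') = ?q (x o\<^sub>L y)" if "x' \<in> ?q x" "y' \<in> ?q y" for x' y'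
      using that \<open>x \<in> A\<close> \<open>y \<in> A\<close>
      by (intro coset_eqI) (auto simp: coset_eq star_hom_opD[OF hom] intro: cstar_subalgebraD(5)[OF A])
    then show ?thesis using mem_coset[OF that(1)] mem_coset[OF that(2)] by blast
  qed
  have scale: "(\<Union>x'\<in>?q x. ?q (scale_op c x')) = ?q (scale_op c x)" if "x \<in> A" for x c
  proof -
    have "?q (scale_op c x') = ?q (scale_op c x)" if "x' \<in> ?q x" for x'
      using that \<open>x \<in> A\<close>
      by (intro coset_eqI) (auto simp: coset_eq star_hom_opD[OF hom] intro: cstar_subalgebraD(4)[OF A])
    then show ?thesis using mem_coset[OF that] by blast
  qed
  have star: "(\<Union>x'\<in>?q x. ?q (adj x')) = ?q (adj x)" if "x \<in> A" for x
  proof -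
    have "?q (adj x') = ?q (adj x)" if "x' \<in> ?q x" for x'
      using that \<open>x \<in> A\<close>
      by (intro coset_eqI) (auto simp: coset_eq star_hom_opD[OF hom] intro: cstar_subalgebraD(6)[OF A])
    then show ?thesis using mem_coset[OF that] by blast
  qed
  have sel: "alg_carrier (op_algebra A) = A" "alg_add (op_algebra A) = (+)"
    "alg_mult (op_algebra A) = (o\<^sub>L)" "alg_scale (op_algebra A) = scale_op"
    "alg_star (op_algebra A) = adj"
    by (simp_all add: op_algebra_def)
  show ?thesis
    unfolding star_hom_def quotient_algebra_def star_algebra.simps sel
    by (intro conjI ballI allI funcsetI imageI) (simp_all add: add mult scale star)
qed

text \<open>An arbitrary representative may be chosen because \<phi> is constant on cosets. The
  restriction supplies the extensionality demanded by \<open>canonical_hom\<close>.\<close>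

definition induced :: "'a op set \<Rightarrow> 'b op"
  where "induced = restrict (\<lambda>X. \<phi> (SOME x. x \<in> X)) (alg_coset (op_algebra A) J ` A)"

lemma induced_coset:
  assumes "x \<in> A"
  shows "induced (alg_coset (op_algebra A) J x) = \<phi> x"
proof -
  have "(SOME y. y \<in> alg_coset (op_algebra A) J x) \<in> alg_coset (op_algebra A) J x"
    using mem_coset[OF assms] by (rule someI)
  then show ?thesis using assms by (simp add: induced_def coset_eq)
qed

lemma star_iso_induced: "star_iso (quotient_algebra (op_algebra A) J) (op_algebra B) induced"
proof -
  let ?q = "alg_coset (op_algebra A) J" and ?Q = "quotient_algebra (op_algebra A) J"
  have carrier: "alg_carrier ?Q = ?q ` A"
    by (simp add: quotient_algebra_def op_algebra_def)
  have q: "alg_add ?Q (?q x) (?q y) = ?q (x + y)" "alg_mult ?Q (?q x) (?q y) = ?q (x o\<^sub>L y)"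
    "alg_scale ?Q c (?q x) = ?q (scale_op c x)" "alg_star ?Q (?q x) = ?q (adj x)"
    if "x \<in> A" "y \<in> A" for x y c
    using star_hom_coset that unfolding star_hom_def by (auto simp: op_algebra_def)
  have "star_hom ?Q (op_algebra B) induced"
    unfolding star_hom_def carrier
    by (auto simp: q induced_coset star_hom_opD[OF hom] cstar_subalgebraD[OF A])
      (auto simp: op_algebra_def star_hom_opD[OF hom])
  moreover have "bij_betw induced (?q ` A) B"
    unfolding bij_betw_def
  proof
    show "inj_on induced (?q ` A)"
    proof (rule inj_onI)
      fix X Y assume "X \<in> ?q ` A" "Y \<in> ?q ` A" and eq: "induced X = induced Y"
      then obtain x y where "x \<in> A" "y \<in> A" "X = ?q x" "Y = ?q y" by blast
      with eq show "X = Y" by (simp add: induced_coset coset_eqI[of x y])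
    qed
    show "induced ` ?q ` A = B"
      using surj by (auto simp: image_image induced_coset)
  qed
  ultimately show ?thesis
    by (simp add: star_iso_def carrier) (simp add: op_algebra_def)
qed

end

section \<open>Operators induced by partial injections\<close>

lemma coord_partial_op:
  "coord (blinfun_apply (partial_op f) v) t = (case pinv f t of None \<Rightarrow> 0 | Some s \<Rightarrow> coord v s)"
  by (simp add: partial_op.rep_eq pull_ell2.rep_eq pull_def)

lemma option_eqI: "(\<And>z. x = Some z \<longleftrightarrow> y = Some z) \<Longrightarrow> x = y"
  by (cases x; cases y; auto)

lemma pinv_pinv:
  assumes "inj_on f (dom f)"
  shows "pinv (pinv f) = f"
  by (rule ext, rule option_eqI) (simp add: pinv_eq_Some_iff[OF inj_pinv] pinv_eq_Some_iff[OF assms])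

lemma pinv_comp:
  assumes "inj_on f (dom f)" "inj_on g (dom g)"
  shows "pinv (f \<circ>\<^sub>m g) = pinv g \<circ>\<^sub>m pinv f"
proof (rule ext, rule option_eqI)
  fix x z
  show "pinv (f \<circ>\<^sub>m g) x = Some z \<longleftrightarrow> (pinv g \<circ>\<^sub>m pinv f) x = Some z"
    using assms
    by (auto simp: pinv_eq_Some_iff map_comp_inj map_comp_Some_iff)
qed

lemma partial_op_comp:
  assumes "inj_on f (dom f)" "inj_on g (dom g)"
  shows "partial_op f o\<^sub>L partial_op g = partial_op (f \<circ>\<^sub>m g)"
proof (rule blinfun_eqI, rule ell2_cong)
  fix v t
  show "coord ((partial_op f o\<^sub>L partial_op g) v) t = coord (partial_op (f \<circ>\<^sub>m g) v) t"
    unfolding blinfun_apply_blinfun_compose coord_partial_op pinv_comp[OF assms]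
    by (simp add: coord_partial_op map_comp_def split: option.split)
qed

lemma partial_op_Some: "partial_op Some = id_blinfun"
proof (rule blinfun_eqI, rule ell2_cong)
  fix v :: "'a ell2" and t :: 'a
  have "pinv Some t = Some t" by (rule pinv_eq_Some_iff[THEN iffD2]) auto
  then show "coord (partial_op Some v) t = coord (id_blinfun v) t"
    by (simp add: coord_partial_op)
qed

text \<open>Both inner products are sums over the graph of f, one indexed by the domain and the
  other by the image; f itself reindexes one into the other.\<close>

lemma is_adj_partial_op:
  assumes f: "inj_on f (dom f)"
  shows "is_adj (partial_op (pinv f)) (partial_op f)"
  unfolding is_adj_def
proof (intro allI)
  fix v w
  let ?D = "dom f" and ?g = "the \<circ> f"
  have inj: "inj_on ?g ?D" using f by (auto simp: inj_on_def dom_def)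
  have img: "?g ` ?D = dom (pinv f)"
    using pinv_eq_Some_iff[OF f] by (force simp: dom_def image_iff)
  have "cinner (partial_op (pinv f) v) w
      = (\<Sum>\<^sub>\<infinity>i\<in>?D. cnj (coord v (?g i)) * coord w i)"
    unfolding cinner_def
    by (rule infsum_cong_neutral) (auto simp: coord_partial_op pinv_pinv[OF f] split: option.splits)
  also have "\<dots> = (\<Sum>\<^sub>\<infinity>i\<in>?D. cnj (coord v (?g i)) * coord (partial_op f w) (?g i))"
  proof (rule infsum_cong)
    fix i assume "i \<in> ?D"
    then have "pinv f (?g i) = Some i" using pinv_eq_Some_iff[OF f] by auto
    then show "cnj (coord v (?g i)) * coord w i = cnj (coord v (?g i)) * coord (partial_op f w) (?g i)"
      by (simp add: coord_partial_op)
  qed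
  also have "\<dots> = (\<Sum>\<^sub>\<infinity>j\<in>dom (pinv f). cnj (coord v j) * coord (partial_op f w) j)"
    unfolding infsum_reindex[OF inj, unfolded img] by (simp add: comp_def)
  also have "\<dots> = cinner v (partial_op f w)"
    unfolding cinner_def
    by (rule infsum_cong_neutral) (auto simp: coord_partial_op split: option.splits)
  finally show "cinner (partial_op (pinv f) v) w = cinner v (partial_op f w)" .
qed

section \<open>The left inverse hull\<close>

lemma hull_eqI: "(\<And>x y. pmap f x = Some y \<longleftrightarrow> pmap g x = Some y) \<Longrightarrow> f = g"
  by (rule pmap_inject[THEN iffD1], rule ext, rule option_eqI)

lemma pmap_mult: "pmap (p * q) x = Some z \<longleftrightarrow> (\<exists>y. pmap q x = Some y \<and> pmap p y = Some z)"
  by (simp add: times_left_inverse_hull.rep_eq map_comp_Some_iff)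

lemma pmap_inv: "pmap (inv_elt p) y = Some x \<longleftrightarrow> pmap p x = Some y"
  by (simp add: inv_elt_left_inverse_hull.rep_eq pinv_eq_Some_iff[OF inj_pmap])

text \<open>Left and right multiplication commute by associativity, and commuting with right
  multiplication survives composition and inversion. In particular, domains of hull elements are
  right ideals.\<close>

lemma pmap_right_ideal: "pmap p x = Some y \<Longrightarrow> pmap p (x * a) = Some (y * a)"
proof -
  have "f x = Some y \<Longrightarrow> f (x * a) = Some (y * a)" if "f \<in> hull_maps" for f x y
    using that
  proof (induction arbitrary: x y rule: hull_maps.induct)
    case (lmult s)
    then show ?case by (auto simp: lmult_def mult.assoc)
  next
    case (comp f g)
    then show ?case by (auto simp: map_comp_Some_iff)
  next
    case (pinv f)
    then show ?case by (simp add: pinv_eq_Some_iff[OF hull_maps_inj])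
  qed
  then show "pmap p x = Some y \<Longrightarrow> pmap p (x * a) = Some (y * a)" using pmap by blast
qed

text \<open>The denominator comes first so that \<open>fraction t\<close>, as a function of the
  numerator, is the index map embedding S in the hull as the copy labelled by t.\<close>

lift_definition fraction :: "'a::left_cancel_monoid_mult \<Rightarrow> 'a \<Rightarrow> 'a left_inverse_hull"
  is "\<lambda>t s. lmult s \<circ>\<^sub>m pinv (lmult t)"
  by (intro hull_maps.intros)

lemma pmap_fraction: "pmap (fraction t s) x = Some y \<longleftrightarrow> (\<exists>a. x = t * a \<and> y = s * a)"
  by (auto simp: fraction.rep_eq map_comp_Some_iff pinv_eq_Some_iff[OF inj_lmult]) (auto simp: lmult_def)

lemma pmap_fraction_base: "pmap (fraction t s) t = Some s"
  unfolding pmap_fraction by (rule exI[of _ 1]) simp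

lemma inj_fraction: "inj (fraction t)"
  by (rule injI) (metis pmap_fraction_base option.inject)

text \<open>\<open>inv_elt p * p\<close> is the identity on the domain of p, so it fixes q under
  left multiplication exactly when the image of q lies in that domain.\<close>

lemma source_mult_eq_iff:
  "inv_elt p * p * q = q \<longleftrightarrow> (\<forall>x y. pmap q x = Some y \<longrightarrow> pmap p y \<noteq> None)"
  for p q :: "'a::left_cancel_monoid_mult left_inverse_hull"
proof
  assume eq: "inv_elt p * p * q = q"
  show "\<forall>x y. pmap q x = Some y \<longrightarrow> pmap p y \<noteq> None"
  proof (intro allI impI)
    fix x y assume "pmap q x = Some y"
    then have "pmap (inv_elt p * p * q) x = Some y" and "pmap q x = Some y" by (simp_all add: eq)
    then show "pmap p y \<noteq> None" by (auto simp: pmap_mult)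
  qed
next
  assume *: "\<forall>x y. pmap q x = Some y \<longrightarrow> pmap p y \<noteq> None"
  show "inv_elt p * p * q = q"
  proof (rule hull_eqI)
    fix x z
    have "pmap p y = Some u \<Longrightarrow> pmap p z = Some u \<Longrightarrow> y = z" for y u
      using inj_pmap[of p] by (metis domI inj_on_def)
    then show "pmap (inv_elt p * p * q) x = Some z \<longleftrightarrow> pmap q x = Some z"
      using * by (auto simp: pmap_mult pmap_inv)
  qed
qed

text \<open>The left translation by p in the Wagner-Preston representation of the hull. Through it
  \<open>Lambda p\<close> becomes a \<open>partial_op\<close>, and the general facts on partial
  injections apply.\<close>

definition Lmap :: "'a::left_cancel_monoid_mult left_inverse_hull \<Rightarrow> 'a left_inverse_hull \<rightharpoonup> 'a left_inverse_hull"
  where "Lmap p q = (if \<forall>x y. pmap q x = Some y \<longrightarrow> pmap p y \<noteq> None then Some (p * q) else None)"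

lemma Lambda_hull: "Lambda p = partial_op (Lmap p)"
  unfolding Lambda_def Lmap_def source_mult_eq_iff ..

lemma Lmap_inv: "Lmap (inv_elt p) y = Some x \<longleftrightarrow> Lmap p x = Some y"
proof -
  have "Lmap p x = Some y \<Longrightarrow> Lmap (inv_elt p) y = Some x" for p x y :: "'a left_inverse_hull"
  proof -
    assume "Lmap p x = Some y"
    then have x: "\<forall>a b. pmap x a = Some b \<longrightarrow> pmap p b \<noteq> None" and y: "y = p * x"
      by (auto simp: Lmap_def split: if_splits)
    have "\<forall>a b. pmap y a = Some b \<longrightarrow> pmap (inv_elt p) b \<noteq> None"
      unfolding y pmap_mult using pmap_inv[of p] by auto
    moreover have "inv_elt p * y = x"
      using x source_mult_eq_iff[of p x] unfolding y mult.assoc by simp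
    ultimately show "Lmap (inv_elt p) y = Some x" by (simp add: Lmap_def)
  qed
  moreover have "inv_elt (inv_elt p) = p"
    by (rule hull_eqI) (simp add: pmap_inv)
  ultimately show ?thesis by metis
qed

lemma inj_Lmap: "inj_on (Lmap p) (dom (Lmap p))"
proof (rule inj_onI)
  fix x y assume "x \<in> dom (Lmap p)" and eq: "Lmap p x = Lmap p y"
  then obtain z where "Lmap p x = Some z" by blast
  then show "x = y" using eq Lmap_inv[of p z x] Lmap_inv[of p z y] by simp
qed

lemma pinv_Lmap: "pinv (Lmap p) = Lmap (inv_elt p)"
  by (rule ext, rule option_eqI) (simp add: pinv_eq_Some_iff[OF inj_Lmap] Lmap_inv)

lemma Lmap_comp: "Lmap p \<circ>\<^sub>m Lmap q = Lmap (p * q)"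
proof (rule ext)
  fix x
  define C where "C p q \<longleftrightarrow> (\<forall>a b. pmap q a = Some b \<longrightarrow> pmap p b \<noteq> None)"
    for p q :: "'a left_inverse_hull"
  have L: "Lmap p q = (if C p q then Some (p * q) else None)" for p q :: "'a left_inverse_hull"
    by (simp add: C_def Lmap_def)
  have "C (p * q) x \<longleftrightarrow> C q x \<and> C p (q * x)"
    unfolding C_def pmap_mult times_left_inverse_hull.rep_eq map_comp_def
    by (fastforce split: option.splits)
  then show "(Lmap p \<circ>\<^sub>m Lmap q) x = Lmap (p * q) x"
    by (simp add: L map_comp_def mult.assoc)
qed

text \<open>The image of \<open>fraction t s\<close> is the right ideal sS. Since the domain of p is
  a right ideal, containing sS amounts to containing s, and then p moves the numerator and keeps
  t.\<close>

lemma Lmap_fraction: "Lmap p (fraction t s) = map_option (fraction t) (pmap p s)"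
proof (cases "pmap p s")
  case None
  then have "\<not> (\<forall>x y. pmap (fraction t s) x = Some y \<longrightarrow> pmap p y \<noteq> None)"
    using pmap_fraction_base by metis
  with None show ?thesis unfolding Lmap_def by simp
next
  case (Some r)
  have "\<forall>x y. pmap (fraction t s) x = Some y \<longrightarrow> pmap p y \<noteq> None"
    using pmap_right_ideal[OF Some] by (auto simp: pmap_fraction)
  moreover have "p * fraction t s = fraction t r"
    by (rule hull_eqI) (auto simp: pmap_mult pmap_fraction pmap_right_ideal[OF Some])
  ultimately show ?thesis using Some by (simp add: Lmap_def)
qed

section \<open>The two regular representations as self-adjoint semigroups\<close>

lemma is_adj_omega: "is_adj (omega (inv_elt f)) (omega f)"
  unfolding omega_def inv_elt_left_inverse_hull.rep_eq by (rule is_adj_partial_op[OF inj_pmap])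

lemma omega_mult: "omega f o\<^sub>L omega g = omega (f * g)"
  unfolding omega_def times_left_inverse_hull.rep_eq by (rule partial_op_comp[OF inj_pmap inj_pmap])

lemma is_adj_Lambda: "is_adj (Lambda (inv_elt p)) (Lambda p)"
  for p :: "'a::left_cancel_monoid_mult left_inverse_hull"
  unfolding Lambda_hull pinv_Lmap[symmetric] by (rule is_adj_partial_op[OF inj_Lmap])

lemma Lambda_mult: "Lambda p o\<^sub>L Lambda q = Lambda (p * q)"
  for p :: "'a::left_cancel_monoid_mult left_inverse_hull"
  unfolding Lambda_hull Lmap_comp[symmetric] by (rule partial_op_comp[OF inj_Lmap inj_Lmap])

lemma pmap_fraction_1: "pmap (fraction 1 1) = Some"
  by (rule ext, rule option_eqI) (auto simp: pmap_fraction)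

lemma omega_fraction_1: "omega (fraction 1 1) = id_blinfun"
  by (simp add: omega_def pmap_fraction_1 partial_op_Some)

lemma Lambda_fraction_1: "Lambda (fraction 1 1 :: 'a::left_cancel_monoid_mult left_inverse_hull) = id_blinfun"
proof -
  have "fraction 1 1 * q = q" for q :: "'a left_inverse_hull"
    by (rule hull_eqI) (simp add: pmap_mult pmap_fraction_1)
  then have "Lmap (fraction 1 1 :: 'a left_inverse_hull) = Some"
    by (simp add: Lmap_def pmap_fraction_1 fun_eq_iff)
  then show ?thesis by (simp add: Lambda_hull partial_op_Some)
qed

interpretation omega: star_semigroup "range omega"
  by unfold_locales
    (auto simp: omega_mult intro: is_adj_omega, simp add: omega_def partial_op_clinear)

interpretation Lambda: star_semigroup
  "range (Lambda :: 'a::left_cancel_monoid_mult left_inverse_hull \<Rightarrow> _)"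
  by unfold_locales
    (auto simp: Lambda_mult intro: is_adj_Lambda, simp add: Lambda_hull partial_op_clinear)

text \<open>Each V_s is the image under \<open>omega\<close> of an element of the hull. Conversely,
  composition and inversion of partial injections become product and adjoint of operators, so a
  C*-subalgebra containing every V_s contains every \<open>omega f\<close>.\<close>

lemma cstar_generated_V: "cstar_generated (range V_op) = closure (cspan (range omega))"
proof
  have "V_op s = omega (fraction 1 s)" for s :: 'a
  proof -
    have "pmap (fraction 1 s) = lmult s"
      by (rule ext, rule option_eqI) (auto simp: pmap_fraction lmult_def)
    then show ?thesis by (simp add: V_op_def omega_def)
  qed
  then have "range V_op \<subseteq> closure (cspan (range (omega :: 'a left_inverse_hull \<Rightarrow> _)))"
    using omega.ccspan_base by auto
  then show "cstar_generated (range V_op) \<subseteq> closure (cspan (range (omega :: 'a left_inverse_hull \<Rightarrow> _)))"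
    unfolding cstar_generated_def using omega.cstar_subalgebra_ccspan by blast
next
  show "closure (cspan (range (omega :: 'a left_inverse_hull \<Rightarrow> _))) \<subseteq> cstar_generated (range V_op)"
    unfolding cstar_generated_def
  proof (intro Inter_greatest, elim CollectE conjE)
    fix A :: "'a op set" assume A: "cstar_subalgebra A" "range V_op \<subseteq> A"
    have "partial_op f \<in> A" if "f \<in> hull_maps" for f
      using that
    proof (induction rule: hull_maps.induct)
      case (lmult s)
      then show ?case using A(2) by (auto simp: V_op_def)
    next
      case (comp f g)
      then show ?case
        using cstar_subalgebraD(5)[OF A(1)] partial_op_comp[OF hull_maps_inj hull_maps_inj] by metis
    next
      case (pinv f)
      then show ?case
        using cstar_subalgebraD(6)[OF A(1)] adj_eqI[OF is_adj_partial_op[OF hull_maps_inj]] by metis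
    qed
    then have *: "omega f \<in> A" for f :: "'a left_inverse_hull" by (simp add: omega_def pmap)
    show "closure (cspan (range (omega :: 'a left_inverse_hull \<Rightarrow> _))) \<subseteq> A"
    proof
      fix T assume "T \<in> closure (cspan (range (omega :: 'a left_inverse_hull \<Rightarrow> _)))"
      then show "T \<in> A"
      proof (induction rule: closure_cspan_induct)
        case closed
        then show ?case using cstar_subalgebraD(1)[OF A(1)] by simp
      qed (auto simp: * intro: cstar_subalgebraD(2-4)[OF A(1)])
    qed
  qed
qed

text \<open>A product of fractions s/t and u/v is nonempty only if tS and uS meet. Clifford's
  condition then gives a common multiple r = t a = u b generating the intersection, and the product
  is the single fraction with numerator s a and denominator v b.\<close>

lemma hull_maps_clifford:
  assumes "clifford_condition TYPE('a::left_cancel_monoid_mult)"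
    and "(f :: 'a \<rightharpoonup> 'a) \<in> hull_maps" and "f \<noteq> Map.empty"
  shows "\<exists>s t. f = lmult s \<circ>\<^sub>m pinv (lmult t)"
  using assms(2,3)
proof (induction rule: hull_maps.induct)
  case (lmult s)
  have "pinv (lmult 1) = (Some :: 'a \<rightharpoonup> 'a)"
    by (rule ext, rule option_eqI) (auto simp: pinv_eq_Some_iff[OF inj_lmult], auto simp: lmult_def)
  then show ?case by (intro exI[of _ s] exI[of _ 1]) (simp add: map_comp_def)
next
  case (pinv f)
  then have "f \<noteq> Map.empty" by (auto simp: pinv_def)
  with pinv.IH obtain s t where f: "f = lmult s \<circ>\<^sub>m pinv (lmult t)" by blast
  have "pinv f = lmult t \<circ>\<^sub>m pinv (lmult s)"
    unfolding f by (simp add: pinv_comp inj_lmult inj_pinv pinv_pinv)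
  then show ?case by blast
next
  case (comp f g)
  have "f \<noteq> Map.empty" "g \<noteq> Map.empty"
    using comp.prems by (auto simp: map_comp_def fun_eq_iff split: option.splits)
  with comp.IH obtain s t u v where f: "f = lmult s \<circ>\<^sub>m pinv (lmult t)"
    and g: "g = lmult u \<circ>\<^sub>m pinv (lmult v)" by blast
  have fS: "f x = Some y \<longleftrightarrow> (\<exists>a. x = t * a \<and> y = s * a)" for x y
    unfolding f by (auto simp: map_comp_Some_iff pinv_eq_Some_iff[OF inj_lmult]) (auto simp: lmult_def)
  have gS: "g x = Some y \<longleftrightarrow> (\<exists>a. x = v * a \<and> y = u * a)" for x y
    unfolding g by (auto simp: map_comp_Some_iff pinv_eq_Some_iff[OF inj_lmult]) (auto simp: lmult_def)
  obtain x z where "(f \<circ>\<^sub>m g) x = Some z" using comp.prems by (auto simp: fun_eq_iff)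
  then have "range ((*) t) \<inter> range ((*) u) \<noteq> {}" by (auto simp: map_comp_Some_iff fS gS)
  then obtain r where r: "range ((*) t) \<inter> range ((*) u) = range ((*) r)"
    using assms(1) unfolding clifford_condition_def by blast
  \<comment> \<open>As r = r 1 lies in both ideals, a and b exist. Any coincidence u d = t e equals
    r c for some c, and left cancellation forces d = b c and e = a c.\<close>
  have "r * 1 \<in> range ((*) t) \<inter> range ((*) u)" unfolding r by blast
  then have "r \<in> range ((*) t)" "r \<in> range ((*) u)" by simp_all
  then obtain a b where ab: "r = t * a" "r = u * b" by blast
  have "f \<circ>\<^sub>m g = lmult (s * a) \<circ>\<^sub>m pinv (lmult (v * b))"
  proof (rule ext, rule option_eqI)
    fix x z
    have "(lmult (s * a) \<circ>\<^sub>m pinv (lmult (v * b))) x = Some z \<longleftrightarrow> (\<exists>c. x = v * (b * c) \<and> z = s * (a * c))"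
      by (auto simp: map_comp_Some_iff pinv_eq_Some_iff[OF inj_lmult])
        (auto simp: lmult_def mult.assoc)
    moreover have "(f \<circ>\<^sub>m g) x = Some z \<longleftrightarrow> (\<exists>d e. x = v * d \<and> u * d = t * e \<and> z = s * e)"
      by (auto simp: map_comp_Some_iff fS gS)
    moreover have "(\<exists>d e. x = v * d \<and> u * d = t * e \<and> z = s * e) \<longleftrightarrow>
        (\<exists>c. x = v * (b * c) \<and> z = s * (a * c))"
    proof
      assume "\<exists>d e. x = v * d \<and> u * d = t * e \<and> z = s * e"
      then obtain d e where de: "x = v * d" "u * d = t * e" "z = s * e" by blast
      then have "u * d \<in> range ((*) t) \<inter> range ((*) u)" by (metis IntI rangeI)
      then obtain c where c: "u * d = r * c" unfolding r by blast
      then have "u * d = u * (b * c)" "t * e = t * (a * c)"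
        using ab de(2) by (metis mult.assoc)+
      then have "d = b * c" "e = a * c" by (auto dest: mult_left_imp_eq)
      with de show "\<exists>c. x = v * (b * c) \<and> z = s * (a * c)" by blast
    next
      assume "\<exists>c. x = v * (b * c) \<and> z = s * (a * c)"
      then obtain c where c: "x = v * (b * c)" "z = s * (a * c)" by blast
      have "u * (b * c) = t * (a * c)" using ab by (metis mult.assoc)
      with c show "\<exists>d e. x = v * d \<and> u * d = t * e \<and> z = s * e" by blast
    qed
    ultimately show "(f \<circ>\<^sub>m g) x = Some z \<longleftrightarrow> (lmult (s * a) \<circ>\<^sub>m pinv (lmult (v * b))) x = Some z"
      by simp
  qed
  then show ?case by blast
qed

lemma fraction_cases:
  assumes "clifford_condition TYPE('a::left_cancel_monoid_mult)"
    and "pmap (q :: 'a left_inverse_hull) \<noteq> Map.empty"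
  shows "\<exists>t s. q = fraction t s"
  using hull_maps_clifford[OF assms(1) pmap assms(2)] pmap_inject fraction.rep_eq by metis

text \<open>If \<open>tS = t'S\<close>, then \<open>t' = t u\<close> for a unit \<open>u\<close>.\<close>

lemma fraction_denominator:
  assumes "range ((*) t) = range ((*) t')"
  shows "\<exists>r. fraction t s = fraction t' r"
proof -
  have "t' * 1 \<in> range ((*) t)" unfolding assms by blast
  then obtain u where u: "t' = t * u" by auto
  have "t * 1 \<in> range ((*) t')" unfolding assms[symmetric] by blast
  then obtain w where w: "t = t' * w" by auto
  \<comment> \<open>Cancelling t leaves u w = 1, which rewrites s a as s u (w a).\<close>
  have "t * (u * w) = t * 1" using u w by (metis mult.assoc mult.right_neutral)
  then have uw: "u * w = 1" by (rule mult_left_imp_eq)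
  have "fraction t s = fraction t' (s * u)"
  proof (rule hull_eqI)
    fix x y
    have "(\<exists>a. x = t * a \<and> y = s * a) \<longleftrightarrow> (\<exists>a. x = t' * a \<and> y = s * u * a)"
    proof
      assume "\<exists>a. x = t * a \<and> y = s * a"
      then obtain a where "x = t * a" "y = s * a" by blast
      then have "x = t' * (w * a)" "y = s * u * (w * a)"
        using w uw by (metis mult.assoc, metis mult.assoc mult.left_neutral)
      then show "\<exists>a. x = t' * a \<and> y = s * u * a" by blast
    next
      assume "\<exists>a. x = t' * a \<and> y = s * u * a"
      then show "\<exists>a. x = t * a \<and> y = s * a" unfolding u mult.assoc by blast
    qed
    then show "pmap (fraction t s) x = Some y \<longleftrightarrow> pmap (fraction t' (s * u)) x = Some y"
      by (simp add: pmap_fraction)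
  qed
  then show ?thesis by blast
qed

lemma fraction_eqD:
  assumes "fraction t s = fraction t' s'"
  shows "range ((*) t) = range ((*) t')"
proof -
  have "range ((*) t) = dom (pmap (fraction t s))" for t s :: 'a
    by (auto simp: dom_def pmap_fraction)
  then show ?thesis using assms by metis
qed

section \<open>Transport along injections of index sets\<close>

lemma comap_summable:
  fixes v :: "'a \<Rightarrow> complex" and j :: "'b \<Rightarrow> 'a"
  assumes "inj j" "(\<lambda>i. (cmod (v i))\<^sup>2) summable_on UNIV"
  shows "(\<lambda>i. (cmod (v (j i)))\<^sup>2) summable_on UNIV"
    and "(\<Sum>\<^sub>\<infinity>i. (cmod (v (j i)))\<^sup>2) = (\<Sum>\<^sub>\<infinity>i\<in>range j. (cmod (v i))\<^sup>2)"
    and "(\<Sum>\<^sub>\<infinity>i. (cmod (v (j i)))\<^sup>2) \<le> (\<Sum>\<^sub>\<infinity>i. (cmod (v i))\<^sup>2)"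
proof -
  have img: "(\<lambda>i. (cmod (v i))\<^sup>2) summable_on range j"
    using assms(2) by (rule summable_on_subset_banach) simp
  then show "(\<lambda>i. (cmod (v (j i)))\<^sup>2) summable_on UNIV"
    using summable_on_reindex[OF assms(1), of "\<lambda>i. (cmod (v i))\<^sup>2"] by (simp add: comp_def)
  show eq: "(\<Sum>\<^sub>\<infinity>i. (cmod (v (j i)))\<^sup>2) = (\<Sum>\<^sub>\<infinity>i\<in>range j. (cmod (v i))\<^sup>2)"
    using infsum_reindex[OF assms(1), of "\<lambda>i. (cmod (v i))\<^sup>2"] by (simp add: comp_def)
  show "(\<Sum>\<^sub>\<infinity>i. (cmod (v (j i)))\<^sup>2) \<le> (\<Sum>\<^sub>\<infinity>i. (cmod (v i))\<^sup>2)"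
    unfolding eq by (rule infsum_mono_neutral) (use img assms in auto)
qed

text \<open>Restriction of coordinates along j. The value 0 for noninjective j keeps the map bounded
  for every j, so that it lifts to an operator without a side condition.\<close>

lift_definition comap_ell2 :: "('b \<Rightarrow> 'a) \<Rightarrow> 'a ell2 \<Rightarrow> 'b ell2"
  is "\<lambda>j v i. if inj j then v (j i) else 0"
  subgoal for j v by (cases "inj j") (simp_all add: comap_summable(1))
  done

lift_definition comap_op :: "('b \<Rightarrow> 'a) \<Rightarrow> 'a ell2 \<Rightarrow>\<^sub>L 'b ell2" is comap_ell2
proof (rule bounded_linear_intro)
  fix j :: "'b \<Rightarrow> 'a" and v w :: "'a ell2" and r :: real
  show "comap_ell2 j (v + w) = comap_ell2 j v + comap_ell2 j w"
    by transfer auto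
  show "comap_ell2 j (r *\<^sub>R v) = r *\<^sub>R comap_ell2 j v"
    unfolding scaleR_ell2_def by transfer auto
  have "(norm (comap_ell2 j v))\<^sup>2 \<le> (norm v)\<^sup>2"
    using comap_summable(3)[OF _ coord_summable]
    by (cases "inj j") (simp_all add: norm_ell2_sq comap_ell2.rep_eq infsum_nonneg)
  then show "norm (comap_ell2 j v) \<le> norm v * 1"
    using power2_le_imp_le by simp
qed

lemma coord_comap_op: "inj j \<Longrightarrow> coord (blinfun_apply (comap_op j) v) i = coord v (j i)"
  by (simp add: comap_op.rep_eq comap_ell2.rep_eq)

lift_definition push_ell2 :: "('b \<Rightarrow> 'a) \<Rightarrow> 'b ell2 \<Rightarrow> 'a ell2"
  is "\<lambda>j v q. if inj j \<and> q \<in> range j then v (inv j q) else 0"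
proof -
  fix j :: "'b \<Rightarrow> 'a" and v :: "'b \<Rightarrow> complex"
  assume v: "(\<lambda>i. (cmod (v i))\<^sup>2) summable_on UNIV"
  show "(\<lambda>q. (cmod (if inj j \<and> q \<in> range j then v (inv j q) else 0))\<^sup>2) summable_on UNIV"
  proof (cases "inj j")
    case True
    have "(\<lambda>q. (cmod (v (inv j q)))\<^sup>2) summable_on range j"
      using v summable_on_reindex[OF True, of "\<lambda>q. (cmod (v (inv j q)))\<^sup>2"]
      by (simp add: comp_def inv_f_f[OF True])
    then show ?thesis
      by (rule summable_on_cong_neutral[THEN iffD1, rotated -1]) (use True in auto)
  qed simp
qed

lift_definition push_op :: "('b \<Rightarrow> 'a) \<Rightarrow> 'b ell2 \<Rightarrow>\<^sub>L 'a ell2" is push_ell2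
proof (rule bounded_linear_intro)
  fix j :: "'b \<Rightarrow> 'a" and v w :: "'b ell2" and r :: real
  show "push_ell2 j (v + w) = push_ell2 j v + push_ell2 j w"
    by transfer auto
  show "push_ell2 j (r *\<^sub>R v) = r *\<^sub>R push_ell2 j v"
    unfolding scaleR_ell2_def by transfer auto
  have "(norm (push_ell2 j v))\<^sup>2 \<le> (norm v)\<^sup>2"
  proof (cases "inj j")
    case True
    have "(norm (push_ell2 j v))\<^sup>2 = (\<Sum>\<^sub>\<infinity>q\<in>range j. (cmod (coord v (inv j q)))\<^sup>2)"
      unfolding norm_ell2_sq by (rule infsum_cong_neutral) (auto simp: push_ell2.rep_eq True)
    also have "\<dots> = (norm v)\<^sup>2"
      unfolding norm_ell2_sq infsum_reindex[OF True] by (simp add: comp_def inv_f_f[OF True])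
    finally show ?thesis by simp
  qed (simp add: norm_ell2_sq push_ell2.rep_eq infsum_nonneg)
  then show "norm (push_ell2 j v) \<le> norm v * 1"
    using power2_le_imp_le by simp
qed

lemma comap_push:
  assumes "inj j"
  shows "blinfun_apply (comap_op j) (blinfun_apply (push_op j) v) = v"
  by (rule ell2_cong)
    (simp add: coord_comap_op assms push_op.rep_eq push_ell2.rep_eq inv_f_f[OF assms])

text \<open>Extension by zero along an injection is an isometry, and restriction is its adjoint. The
  two spaces differ, so this cannot be phrased with \<open>is_adj\<close>.\<close>

lemma cinner_push:
  assumes j: "inj j"
  shows "cinner (blinfun_apply (push_op j) v) w = cinner v (blinfun_apply (comap_op j) w)"
proof -
  have "cinner (blinfun_apply (push_op j) v) w
      = (\<Sum>\<^sub>\<infinity>q\<in>range j. cnj (coord v (inv j q)) * coord w q)"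
    unfolding cinner_def
    by (rule infsum_cong_neutral) (auto simp: push_op.rep_eq push_ell2.rep_eq j)
  also have "\<dots> = cinner v (blinfun_apply (comap_op j) w)"
    unfolding cinner_def infsum_reindex[OF j]
    by (simp add: comp_def inv_f_f[OF j] coord_comap_op[OF j])
  finally show ?thesis .
qed

lemma comap_op_scaleC:
  "blinfun_apply (comap_op j) (c *\<^sub>C v) = c *\<^sub>C blinfun_apply (comap_op j) v"
  unfolding comap_op.rep_eq by transfer auto

section \<open>The canonical homomorphism\<close>

text \<open>Coordinates of \<open>Lambda p v\<close> are read through the inverse translation, which
  acts on numerators only. Hence restriction to the copy labelled by t intertwines
  \<open>Lambda p\<close> with \<open>omega p\<close>, for every t.\<close>

lemma comap_Lambda:
  "blinfun_apply (comap_op (fraction t)) (blinfun_apply (Lambda p) v)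
    = blinfun_apply (omega p) (blinfun_apply (comap_op (fraction t)) v)"
proof (rule ell2_cong)
  fix s
  have "pinv (Lmap p) (fraction t s) = map_option (fraction t) (pinv (pmap p) s)"
    by (simp add: pinv_Lmap Lmap_fraction inv_elt_left_inverse_hull.rep_eq)
  then show "coord (comap_op (fraction t) (Lambda p v)) s
      = coord (omega p (comap_op (fraction t) v)) s"
    by (simp add: coord_comap_op[OF inj_fraction] Lambda_hull omega_def coord_partial_op
        split: option.split)
qed

abbreviation hull_alg :: "'a::left_cancel_monoid_mult left_inverse_hull op set"
  where "hull_alg \<equiv> closure (cspan (range Lambda))"

abbreviation omega_alg :: "'a::left_cancel_monoid_mult op set"
  where "omega_alg \<equiv> closure (cspan (range omega))"

text \<open>\<open>W* x W\<close> for the isometry W that embeds the Hilbert space of S as the copy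
  with denominator 1.\<close>

definition compress :: "'a::left_cancel_monoid_mult left_inverse_hull op \<Rightarrow> 'a op"
  where "compress x = comap_op (fraction 1) o\<^sub>L (x o\<^sub>L push_op (fraction 1))"

lemma compress_apply:
  "blinfun_apply (compress x) v
    = blinfun_apply (comap_op (fraction 1)) (blinfun_apply x (blinfun_apply (push_op (fraction 1)) v))"
  by (simp add: compress_def)

lemma compress_Lambda: "compress (Lambda p) = omega p"
  by (rule blinfun_eqI) (simp add: compress_apply comap_Lambda comap_push[OF inj_fraction])

lemma bounded_linear_compress: "bounded_linear compress"
  unfolding compress_def
  by (intro bounded_linear_compose[OF blinfun_comp.bounded_linear_right]
      blinfun_comp.bounded_linear_left)

lemma compress_scale: "compress (scale_op c x) = scale_op c (compress x)"
  by (rule blinfun_eqI) (simp add: compress_apply scale_op_apply comap_op_scaleC)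

lemmas compress_add = linear_add[OF bounded_linear.linear[OF bounded_linear_compress]]
lemmas compress_diff = linear_diff[OF bounded_linear.linear[OF bounded_linear_compress]]
lemmas compress_zero = linear_0[OF bounded_linear.linear[OF bounded_linear_compress]]

lemma continuous_on_compress: "continuous_on S compress"
  by (rule linear_continuous_on[OF bounded_linear_compress])

text \<open>The intertwining extends from the generators because both sides are linear and
  continuous in x. The case t = 1 yields multiplicativity of \<open>compress\<close>; the use of one
  operator for all t yields the norm bound.\<close>

lemma comap_hull_alg:
  assumes "x \<in> hull_alg"
  shows "blinfun_apply (comap_op (fraction t)) (blinfun_apply x v)
    = blinfun_apply (compress x) (blinfun_apply (comap_op (fraction t)) v)"
  using assms
proof (induction arbitrary: v rule: closure_cspan_induct)
  case closed
  show ?case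
    by (intro closed_Collect_all closed_Collect_eq continuous_intros continuous_on_compress)
next
  case (base T)
  then show ?case by (auto simp: comap_Lambda compress_Lambda)
qed (simp_all add: compress_zero compress_add compress_scale blinfun.add_left blinfun.add_right
    blinfun.zero_right scale_op_apply comap_op_scaleC)

lemma compress_in_omega_alg:
  assumes "x \<in> hull_alg"
  shows "compress x \<in> omega_alg"
  using assms
proof (induction rule: closure_cspan_induct)
  case closed
  show ?case
    using closed_vimage[OF closed_closure continuous_on_compress, of "cspan (range omega)"]
    by (simp add: vimage_def)
qed (auto simp: compress_zero compress_add compress_scale compress_Lambda omega.ccspan_zero
    intro: omega.ccspan_add omega.ccspan_scale omega.ccspan_base)

lemma star_hom_compress: "star_hom (op_algebra hull_alg) (op_algebra omega_alg) compress"
proof -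
  \<comment> \<open>Restriction moves past x and turns it into \<open>compress x\<close>; what
    remains of y is then exactly \<open>compress y\<close>, with no projection left between the
    factors.\<close>
  have "compress (x o\<^sub>L y) = compress x o\<^sub>L compress y" if "x \<in> hull_alg" for x y :: "'a left_inverse_hull op"
    by (rule blinfun_eqI) (simp add: compress_apply[of "x o\<^sub>L y"] compress_apply[of y] comap_hull_alg[OF that])
  moreover have "compress (adj x) = adj (compress x)" if "x \<in> hull_alg" for x :: "'a left_inverse_hull op"
  proof -
    have "is_adj (compress (adj x)) (compress x)"
      unfolding is_adj_def
    proof (intro allI)
      fix v w
      let ?W = "blinfun_apply (push_op (fraction 1)) :: 'a ell2 \<Rightarrow> _"
      have "cinner (compress (adj x) v) w = cnj (cinner (?W w) (adj x (?W v)))"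
        unfolding compress_apply cinner_push[OF inj_fraction] by (rule cinner_commute)
      also have "\<dots> = cinner (adj x (?W v)) (?W w)" by (rule cinner_commute[symmetric])
      also have "\<dots> = cinner (?W v) (x (?W w))" by (rule is_adjD[OF Lambda.adj_ccspan(1)[OF that]])
      also have "\<dots> = cinner v (compress x w)"
        unfolding compress_apply cinner_push[OF inj_fraction] ..
      finally show "cinner (compress (adj x) v) w = cinner v (compress x w)" .
    qed
    then show ?thesis by (rule adj_eqI[symmetric])
  qed
  ultimately show ?thesis
    by (auto simp: star_hom_def op_algebra_def compress_in_omega_alg compress_add compress_scale)
qed

section \<open>The kernel and the range of the canonical homomorphism\<close>

text \<open>For \<open>Lambda p\<close> the coordinate at the zero z is unchanged, since
  \<open>inv_elt p * z = z\<close>. Combinations and limits only multiply it by a scalar, which is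
  read off at \<open>ket z\<close>.\<close>

lemma coord_zero_hull_alg:
  assumes z: "pmap z = Map.empty" and "x \<in> hull_alg"
  shows "coord (blinfun_apply x v) z = coord (blinfun_apply x (ket z)) z * coord v z"
  using assms(2)
proof (induction arbitrary: v rule: closure_cspan_induct)
  case closed
  have "continuous_on UNIV (\<lambda>x. coord (blinfun_apply x v) z)" for v
    by (rule bounded_linear.continuous_on[OF bounded_linear_coord]) (intro continuous_intros)
  then show ?case
    by (intro closed_Collect_all closed_Collect_eq continuous_on_mult continuous_on_const)
next
  case (base T)
  then obtain p where p: "T = Lambda p" by blast
  have "inv_elt p * z = z"
    by (rule hull_eqI) (simp add: pmap_mult z)
  then have "pinv (Lmap p) z = Some z"
    unfolding pinv_Lmap Lmap_def by (simp add: z)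
  then show ?case by (simp add: p Lambda_hull coord_partial_op ket.rep_eq)
next
  case (add T R)
  show ?case
    by (simp only: blinfun.add_left coord_add add(1)[of v] add(2)[of v] distrib_right)
next
  case (scale c T)
  show ?case
    by (simp only: scale_op_apply scaleC.rep_eq scale[of v] mult.assoc)
qed (simp add: zero_ell2.rep_eq)

lemma coord_Lambda_zero:
  assumes z: "pmap z = Map.empty"
  shows "coord (blinfun_apply (Lambda z) v) z = coord v z"
    and "omega z = 0"
proof -
  have "inv_elt z * z = z"
    by (rule hull_eqI) (simp add: pmap_mult z)
  then have "pinv (Lmap z) z = Some z"
    unfolding pinv_Lmap Lmap_def by (simp add: z)
  then show "coord (blinfun_apply (Lambda z) v) z = coord v z"
    by (simp add: Lambda_hull coord_partial_op)
  have "pinv (pmap z) = Map.empty"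
    by (rule ext) (simp add: z pinv_def)
  then show "omega z = 0"
    by (intro blinfun_eqI ell2_cong) (simp add: omega_def coord_partial_op zero_ell2.rep_eq)
qed

text \<open>A linear complement of \<open>zero_ideal\<close> in \<open>hull_alg\<close>. Quantifying
  over every q with empty map covers both cases: in a hull without zero the condition is vacuous and
  the whole algebra results.\<close>

definition hull_alg0 :: "'a::left_cancel_monoid_mult left_inverse_hull op set"
  where "hull_alg0 = {x \<in> hull_alg. \<forall>v q. pmap q = Map.empty \<longrightarrow> coord (blinfun_apply x v) q = 0}"

lemma zero_ideal_kernel: "k \<in> zero_ideal \<Longrightarrow> k \<in> hull_alg \<and> compress k = 0"
proof (cases "Map.empty \<in> (hull_maps :: ('a \<rightharpoonup> 'a) set)")
  case True
  let ?z = "Abs_left_inverse_hull Map.empty :: 'a left_inverse_hull"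
  have z: "pmap ?z = Map.empty" using True by (rule Abs_left_inverse_hull_inverse)
  assume "k \<in> zero_ideal"
  then obtain c where "k = scale_op c (Lambda ?z)" using True by (auto simp: zero_ideal_def)
  then show ?thesis
    by (auto simp: compress_scale compress_Lambda coord_Lambda_zero(2)[OF z]
        intro: Lambda.ccspan_scale Lambda.ccspan_base)
qed (auto simp: zero_ideal_def compress_zero Lambda.ccspan_zero)

lemma hull_alg_decomp:
  assumes "x \<in> hull_alg"
  shows "\<exists>k \<in> zero_ideal. x - k \<in> hull_alg0"
proof (cases "Map.empty \<in> (hull_maps :: ('a \<rightharpoonup> 'a) set)")
  case True
  let ?z = "Abs_left_inverse_hull Map.empty :: 'a left_inverse_hull"
  have z: "pmap ?z = Map.empty" using True by (rule Abs_left_inverse_hull_inverse)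
  \<comment> \<open>The character of x on the line. \<open>Lambda ?z\<close> has coefficient 1
    there, so subtracting this multiple cancels the coordinate at zero.\<close>
  define k where "k = scale_op (coord (blinfun_apply x (ket ?z)) ?z) (Lambda ?z)"
  have k: "k \<in> zero_ideal" using True by (auto simp: zero_ideal_def k_def)
  have "x - k \<in> hull_alg"
    using zero_ideal_kernel[OF k] assms cstar_subalgebra_diff[OF Lambda.cstar_subalgebra_ccspan] by blast
  moreover have "coord (blinfun_apply (x - k) v) q = 0" if "pmap q = Map.empty" for v q
  proof -
    have "q = ?z" using that z pmap_inject by metis
    then show ?thesis
      by (simp add: blinfun.diff_left coord_diff coord_zero_hull_alg[OF z assms, of v] k_def
          scale_op_apply scaleC.rep_eq coord_Lambda_zero(1)[OF z])
  qed
  ultimately show ?thesis using k by (auto simp: hull_alg0_def)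
next
  case False
  then have "pmap q \<noteq> Map.empty" for q :: "'a left_inverse_hull" using pmap[of q] by metis
  then show ?thesis using assms False by (auto simp: hull_alg0_def zero_ideal_def)
qed

text \<open>\<open>T\<close> contains one generator of each principal right ideal.\<close>

lemma fraction_partition:
  assumes "clifford_condition TYPE('a::left_cancel_monoid_mult)"
  obtains T :: "'a::left_cancel_monoid_mult set" where
    "bij_betw (\<lambda>(t, s). fraction t s) (T \<times> UNIV) {q. pmap q \<noteq> Map.empty}"
proof -
  \<comment> \<open>The choice depends on t only through its ideal, so generators of the same ideal
    share a representative and no fraction is counted twice.\<close>
  define rep where "rep t = (SOME u. range ((*) u) = range ((*) t))" for t :: 'a
  have rep: "range ((*) (rep t)) = range ((*) t)" for t
    unfolding rep_def by (rule someI) (rule refl)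
  have rep_eq: "rep t = rep u" if "range ((*) t) = range ((*) u)" for t u
    unfolding rep_def that ..
  have "bij_betw (\<lambda>(t, s). fraction t s) (range rep \<times> UNIV) {q. pmap q \<noteq> Map.empty}"
    unfolding bij_betw_def
  proof
    show "inj_on (\<lambda>(t, s). fraction t s) (range rep \<times> UNIV)"
    proof (rule inj_onI, clarify)
      fix t s t' s' assume eq: "fraction (rep t) s = fraction (rep t') s'"
      then have "range ((*) t) = range ((*) t')" using fraction_eqD[OF eq] by (simp add: rep)
      then have "rep t = rep t'" by (rule rep_eq)
      with eq show "rep t = rep t' \<and> s = s'" using inj_fraction[of "rep t'"] by (auto dest: injD)
    qed
    show "(\<lambda>(t, s). fraction t s) ` (range rep \<times> UNIV) = {q. pmap q \<noteq> Map.empty}"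
    proof
      show "(\<lambda>(t, s). fraction t s) ` (range rep \<times> UNIV) \<subseteq> {q. pmap q \<noteq> Map.empty}"
      proof (rule image_subsetI, clarify)
        fix t s assume "pmap (fraction (rep t) s) = Map.empty"
        then show False using pmap_fraction_base[of "rep t" s] by simp
      qed
      show "{q. pmap q \<noteq> Map.empty} \<subseteq> (\<lambda>(t, s). fraction t s) ` (range rep \<times> UNIV)"
      proof clarify
        fix q :: "'a left_inverse_hull" assume "pmap q \<noteq> Map.empty"
        then obtain t s where "q = fraction t s" using fraction_cases[OF assms] by blast
        moreover obtain r where "fraction t s = fraction (rep t) r"
          using fraction_denominator[OF rep[symmetric]] by blast
        ultimately show "q \<in> (\<lambda>(t, s). fraction t s) ` (range rep \<times> UNIV)" by force
      qed
    qed
  qed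
  then show ?thesis by (rule that)
qed

text \<open>Vanishing at zero makes |xv|^2 the sum of the squared norms of its restrictions to the
  copies. Each restriction is \<open>compress x\<close> applied to the restriction of v, and the
  squared norms of the latter sum to at most |v|^2.\<close>

lemma norm_le_compress:
  assumes "clifford_condition TYPE('a::left_cancel_monoid_mult)"
    and x: "x \<in> (hull_alg0 :: 'a left_inverse_hull op set)"
  shows "norm x \<le> norm (compress x)"
proof (rule norm_blinfun_bound)
  fix v
  let ?E = "{q :: 'a left_inverse_hull. pmap q \<noteq> Map.empty}"
  let ?R = "\<lambda>t. blinfun_apply (comap_op (fraction t))"
  obtain T :: "'a set" where T: "bij_betw (\<lambda>(t, s). fraction t s) (T \<times> UNIV) ?E"
    using fraction_partition[OF assms(1)] .
  have norm_R: "(norm (?R t u))\<^sup>2 = (\<Sum>\<^sub>\<infinity>s. (cmod (coord u (fraction t s)))\<^sup>2)" for t u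
    by (simp add: norm_ell2_sq coord_comap_op[OF inj_fraction])
  have summ: "(\<lambda>(t, s). (cmod (coord u (fraction t s)))\<^sup>2) summable_on T \<times> UNIV" for u
  proof -
    have "(\<lambda>q. (cmod (coord u q))\<^sup>2) summable_on ?E"
      using coord_summable by (rule summable_on_subset_banach) simp
    then show ?thesis
      using summable_on_reindex_bij_betw[OF T, of "\<lambda>q. (cmod (coord u q))\<^sup>2"]
      by (simp add: case_prod_unfold)
  qed
  have sum_R: "(\<lambda>t. (norm (?R t u))\<^sup>2) summable_on T" for u
    unfolding norm_R using summable_on_Sigma_banach[OF summ[of u]] by simp
  have norm_E: "(\<Sum>\<^sub>\<infinity>q\<in>?E. (cmod (coord u q))\<^sup>2) = (\<Sum>\<^sub>\<infinity>t\<in>T. (norm (?R t u))\<^sup>2)" for u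
  proof -
    have "(\<Sum>\<^sub>\<infinity>q\<in>?E. (cmod (coord u q))\<^sup>2)
        = (\<Sum>\<^sub>\<infinity>(t, s)\<in>T \<times> UNIV. (cmod (coord u (fraction t s)))\<^sup>2)"
      using infsum_reindex_bij_betw[OF T, of "\<lambda>q. (cmod (coord u q))\<^sup>2"]
      by (simp add: case_prod_unfold)
    also have "\<dots> = (\<Sum>\<^sub>\<infinity>t\<in>T. (norm (?R t u))\<^sup>2)"
      unfolding norm_R by (rule infsum_Sigma'_banach[symmetric]) (rule summ)
    finally show ?thesis .
  qed
  have "(norm (blinfun_apply x v))\<^sup>2 = (\<Sum>\<^sub>\<infinity>q\<in>?E. (cmod (coord (blinfun_apply x v) q))\<^sup>2)"
    unfolding norm_ell2_sq by (rule infsum_cong_neutral) (use x in \<open>auto simp: hull_alg0_def\<close>)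
  also have "\<dots> = (\<Sum>\<^sub>\<infinity>t\<in>T. (norm (?R t (blinfun_apply x v)))\<^sup>2)" by (rule norm_E)
  also have "\<dots> \<le> (\<Sum>\<^sub>\<infinity>t\<in>T. (norm (compress x))\<^sup>2 * (norm (?R t v))\<^sup>2)"
  proof (rule infsum_mono)
    fix t
    have "?R t (blinfun_apply x v) = blinfun_apply (compress x) (?R t v)"
      using x by (intro comap_hull_alg) (simp add: hull_alg0_def)
    then show "(norm (?R t (blinfun_apply x v)))\<^sup>2 \<le> (norm (compress x))\<^sup>2 * (norm (?R t v))\<^sup>2"
      unfolding power_mult_distrib[symmetric] by (simp add: power_mono norm_blinfun)
  qed (intro sum_R summable_on_cmult_right)+
  also have "\<dots> = (norm (compress x))\<^sup>2 * (\<Sum>\<^sub>\<infinity>q\<in>?E. (cmod (coord v q))\<^sup>2)"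
    unfolding norm_E by (rule infsum_cmult_right) (rule sum_R)
  also have "\<dots> \<le> (norm (compress x))\<^sup>2 * (norm v)\<^sup>2"
    unfolding norm_ell2_sq[of v]
  proof (intro mult_left_mono infsum_mono_neutral)
    show "(\<lambda>q. (cmod (coord v q))\<^sup>2) summable_on ?E"
      using coord_summable by (rule summable_on_subset_banach) simp
  qed (auto intro: coord_summable)
  finally show "norm (blinfun_apply x v) \<le> norm (compress x) * norm v"
    unfolding power_mult_distrib[symmetric] by (rule power2_le_imp_le) simp
qed simp

text \<open>Removing its component in \<open>zero_ideal\<close> from \<open>Lambda f\<close> gives a
  preimage of \<open>omega f\<close> in \<open>hull_alg0\<close>. The image of this closed subspace
  is a closed complex subspace, so it contains the closed span.\<close>

lemma compress_surj:
  assumes "clifford_condition TYPE('a::left_cancel_monoid_mult)"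
  shows "compress ` hull_alg = (omega_alg :: 'a op set)"
proof
  show "compress ` hull_alg \<subseteq> (omega_alg :: 'a op set)" using compress_in_omega_alg by blast
  let ?A0 = "hull_alg0 :: 'a left_inverse_hull op set"
  have zero: "0 \<in> ?A0" by (simp add: hull_alg0_def Lambda.ccspan_zero zero_ell2.rep_eq)
  have add: "x + y \<in> ?A0" if "x \<in> ?A0" "y \<in> ?A0" for x y
    using that by (simp add: hull_alg0_def Lambda.ccspan_add blinfun.add_left coord_add)
  have scale: "scale_op c x \<in> ?A0" if "x \<in> ?A0" for x c
    using that by (simp add: hull_alg0_def Lambda.ccspan_scale scale_op_apply scaleC.rep_eq)
  have "?A0 = hull_alg \<inter> {x. \<forall>v q. pmap q = Map.empty \<longrightarrow> coord (blinfun_apply x v) q = 0}"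
    by (auto simp: hull_alg0_def)
  also have "closed \<dots>"
  proof (intro closed_Int closed_closure closed_Collect_all closed_Collect_imp open_Collect_const)
    fix v :: "'a left_inverse_hull ell2" and q
    have "continuous_on UNIV (\<lambda>x. coord (blinfun_apply x v) q)"
      by (rule bounded_linear.continuous_on[OF bounded_linear_coord]) (intro continuous_intros)
    then show "closed {x. coord (blinfun_apply x v) q = 0}"
      by (intro closed_Collect_eq continuous_on_const)
  qed
  finally have "complete ?A0" by (simp add: complete_eq_closed)
  moreover have "subspace ?A0"
    by (auto simp: subspace_def zero add scale scaleR_conv_scale_op)
  \<comment> \<open>The constant 1 is the lower bound of \<open>compress\<close> on
    \<open>?A0\<close>; a bounded linear map that is bounded below carries complete subspaces to
    complete ones.\<close>
  ultimately have "complete (compress ` ?A0)"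
    using norm_le_compress[OF assms]
    by (intro complete_isometric_image[of 1] bounded_linear_compress) auto
  then have "closed (compress ` ?A0)" by (rule complete_imp_closed)
  moreover have "cspan (range omega) \<subseteq> compress ` ?A0"
  proof (rule op.span_minimal)
    show "range omega \<subseteq> compress ` ?A0"
    proof clarify
      fix f :: "'a left_inverse_hull"
      obtain k where k: "k \<in> zero_ideal" "Lambda f - k \<in> ?A0"
        using hull_alg_decomp[OF Lambda.ccspan_base[of "Lambda f"]] by blast
      then have "compress (Lambda f - k) = omega f"
        by (simp add: compress_diff compress_Lambda zero_ideal_kernel)
      with k(2) show "omega f \<in> compress ` ?A0" by (metis imageI)
    qed
    show "module.subspace scale_op (compress ` ?A0)"
    proof (rule op.subspaceI)
      show "0 \<in> compress ` ?A0" using zero compress_zero by (metis imageI)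
      show "x + y \<in> compress ` ?A0" if "x \<in> compress ` ?A0" "y \<in> compress ` ?A0" for x y
        using that add by (auto simp: compress_add[symmetric])
      show "scale_op c x \<in> compress ` ?A0" if "x \<in> compress ` ?A0" for c x
        using that scale by (auto simp: compress_scale[symmetric])
    qed
  qed
  ultimately have "omega_alg \<subseteq> compress ` ?A0" by (intro closure_minimal)
  then show "(omega_alg :: 'a op set) \<subseteq> compress ` hull_alg" by (auto simp: hull_alg0_def)
qed

text \<open>Subtracting the component in \<open>zero_ideal\<close> leaves an element still killed by
  \<open>compress\<close>, but now in the subspace where its norm is bounded by that of its image;
  so it is 0.\<close>

lemma compress_kernel:
  assumes "clifford_condition TYPE('a::left_cancel_monoid_mult)"
  shows "zero_ideal = {x \<in> (hull_alg :: 'a left_inverse_hull op set). compress x = 0}"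
proof (intro equalityI subsetI)
  fix x :: "'a left_inverse_hull op" assume "x \<in> {x \<in> hull_alg. compress x = 0}"
  then have x: "x \<in> hull_alg" "compress x = 0" by auto
  obtain k where k: "k \<in> zero_ideal" "x - k \<in> hull_alg0" using hull_alg_decomp[OF x(1)] by blast
  have "norm (x - k) \<le> norm (compress (x - k))" by (rule norm_le_compress[OF assms k(2)])
  also have "compress (x - k) = 0" by (simp add: compress_diff x zero_ideal_kernel[OF k(1)])
  finally show "x \<in> zero_ideal" using k(1) by simp
qed (use zero_ideal_kernel in blast)

lemma star_hom_comp: "star_hom A B f \<Longrightarrow> star_hom B C g \<Longrightarrow> star_hom A C (\<lambda>x. g (f x))"
  by (simp add: star_hom_def Pi_iff)

theorem corollary3p2p17:
  fixes S :: "'a::cancel_monoid_mult itself"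
  assumes "clifford_condition S"
  shows "(\<exists>!h :: 'a left_inverse_hull op set \<Rightarrow> 'a op. canonical_hom h) \<and>
    (\<forall>h :: 'a left_inverse_hull op set \<Rightarrow> 'a op.
      canonical_hom h \<longrightarrow> star_iso hull_cstar0 semigroup_cstar h)"
proof -
  have C: "clifford_condition TYPE('a)" using assms by (simp add: clifford_condition_def)
  interpret surj_star_hom hull_alg omega_alg compress "zero_ideal :: 'a left_inverse_hull op set"
    by unfold_locales
      (fact Lambda.cstar_subalgebra_ccspan star_hom_compress compress_surj[OF C] compress_kernel[OF C])+
  have B: "semigroup_cstar = op_algebra (omega_alg :: 'a op set)"
    by (simp add: semigroup_cstar_def cstar_generated_V)
  have Q: "hull_cstar0 = quotient_algebra (op_algebra hull_alg) (zero_ideal :: 'a left_inverse_hull op set)"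
    by (simp add: hull_cstar0_def inverse_semigroup_cstar_def)
  let ?q = "alg_coset (op_algebra hull_alg) (zero_ideal :: 'a left_inverse_hull op set)"
  have carrier: "alg_carrier hull_cstar0 = ?q ` hull_alg"
    by (simp add: Q quotient_algebra_def op_algebra_def)
  have Lambda0: "Lambda0 f = ?q (Lambda f)" for f
    by (simp add: Lambda0_def inverse_semigroup_cstar_def)
  have iso: "star_iso hull_cstar0 semigroup_cstar induced"
    unfolding Q B by (rule star_iso_induced)
  have Lambda_mem: "Lambda f \<in> hull_alg" for f :: "'a left_inverse_hull"
    by (rule Lambda.ccspan_base) simp
  have canonical: "canonical_hom induced"
    unfolding canonical_hom_def
  proof (intro conjI allI)
    show "induced \<in> extensional (alg_carrier hull_cstar0)"
      unfolding carrier induced_def by (rule restrict_extensional)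
    show "star_hom hull_cstar0 semigroup_cstar induced" using iso by (simp add: star_iso_def)
    show "induced (Lambda0 f) = omega f" for f
      by (simp add: Lambda0 induced_coset[OF Lambda_mem] compress_Lambda)
  qed
  \<comment> \<open>\<open>fraction 1 1\<close> acts as the identity, so any \<psi> carrying
    \<open>Lambda\<close> to \<open>omega\<close> is unital.\<close>
  have unital: "unital_star_hom hull_alg (omega_alg :: 'a op set) \<psi>"
    if "star_hom (op_algebra hull_alg) (op_algebra omega_alg) \<psi>" "\<And>f. \<psi> (Lambda f) = omega f" for \<psi>
  proof
    show "id_blinfun \<in> (hull_alg :: 'a left_inverse_hull op set)"
      using Lambda_mem[of "fraction 1 1"] by (simp add: Lambda_fraction_1)
    show "\<psi> id_blinfun = id_blinfun"
      using that(2)[of "fraction 1 1"] by (simp add: Lambda_fraction_1 omega_fraction_1)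
  qed (fact Lambda.cstar_subalgebra_ccspan Lambda.adj_ccspan(1) omega.adj_ccspan(1) that(1))+
  \<comment> \<open>Composing h with the quotient map moves the comparison to
    \<open>hull_alg\<close>, an algebra of operators with a norm, where automatic continuity
    applies. Off the carrier, extensionality decides.\<close>
  have unique: "h = induced" if h: "canonical_hom h" for h
  proof -
    have "star_hom (op_algebra hull_alg) (op_algebra omega_alg) (\<lambda>x. h (?q x))"
      using h star_hom_comp[OF star_hom_coset] unfolding canonical_hom_def Q B by blast
    moreover have "h (?q (Lambda f)) = omega f" for f
      using h by (simp add: canonical_hom_def Lambda0)
    ultimately have \<psi>: "unital_star_hom hull_alg omega_alg (\<lambda>x. h (?q x))" by (rule unital)
    have \<phi>: "unital_star_hom hull_alg (omega_alg :: 'a op set) compress"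
      by (rule unital) (fact star_hom_compress compress_Lambda)+
    have "h (?q x) = induced (?q x)" if "x \<in> hull_alg" for x
      unfolding induced_coset[OF that]
      by (rule unital_star_hom_eqI[OF \<psi> \<phi> _ that])
        (use h in \<open>auto simp: canonical_hom_def Lambda0 compress_Lambda\<close>)
    then show ?thesis
      using h canonical
      by (intro extensionalityI[of h "alg_carrier hull_cstar0" induced])
        (auto simp: canonical_hom_def carrier)
  qed
  show ?thesis using canonical iso unique by blast
qed

end
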